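(* Let $F$ be a field and let $k\ge 1$ be an integer. The map $\mathcal{F}^2_k : PF^2(k)\to PF$, $(\psi_1,\psi_2)\mapsto \varphi_1\otimes\varphi_2\otimes\pi$, where $\pi$ is a $k$-fold quadratic Pfister form and $\varphi_1,\varphi_2$ are bilinear Pfister forms with $\psi_1=\varphi_1\otimes\pi$ and $\psi_2=\varphi_2\otimes\pi$, is well-defined. That is: if $\psi_1,\psi_2$ are quadratic Pfister forms over $F$, $\pi$ and $\mu$ are $k$-fold quadratic Pfister forms over $F$, and $\varphi_1,\varphi_2,\tau_1,\tau_2$ are bilinear Pfister forms over $F$ such that $\psi_1=\varphi_1\otimes\pi=\tau_1\otimes\mu$ and $\psi_2=\varphi_2\otimes\pi=\tau_2\otimes\mu$, then $\varphi_1\otimes\varphi_2\otimes\pi=\tau_1\otimes\tau_2\otimes\mu$.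
   Context: $F$ is a field of arbitrary characteristic; equality of forms means isometry. For $a\in F^\times$, $\langle\langle a\rangle\rangle$ denotes the symmetric bilinear form $\langle 1,-a\rangle$, and an $r$-fold bilinear Pfister form is $\langle\langle a_1,\dots,a_r\rangle\rangle=\langle\langle a_1\rangle\rangle\otimes\cdots\otimes\langle\langle a_r\rangle\rangle$ with $a_i\in F^\times$ (the $0$-fold one is $\langle 1\rangle$). For a diagonal bilinear form $B=\langle b_1,\dots,b_s\rangle$ and a quadratic form $q$, $B\otimes q = b_1q\perp\cdots\perp b_sq$. For $n\ge1$, an $n$-fold quadratic Pfister form is: if $\operatorname{char}F\ne2$, the $2^n$-dimensional quadratic form $\langle\langle\alpha_1,\dots,\alpha_n\rangle\rangle=\perp_{c_1,\dots,c_n\in\{0,1\}}\langle(-1)^{c_1+\cdots+c_n}\alpha_1^{c_1}\cdots\alpha_n^{c_n}\rangle$ with $\alpha_i\in F^\times$; if $\operatorname{char}F=2$, the form $\langle\langle\alpha_1,\dots,\alpha_{n-1},\alpha_n]]=\langle\langle\alpha_1,\dots,\alpha_{n-1}\rangle\rangle\otimes[1,\alpha_n]$ with $\alpha_1,\dots,\alpha_{n-1}\in F^\times$, $\alpha_n\in F$, where $[1,\alpha]$ is the quadratic form $x^2+xy+\alpha y^2$. $PF$ is the set of (isometry classes of) quadratic Pfister forms over $F$. Quadratic Pfister forms $\psi_1,\psi_2$ are $k$-linked (i.e. separably $k$-linked) if there are a $k$-fold quadratic Pfister form $\pi$ and bilinear Pfister forms $B_1,B_2$ with $\psi_1=B_1\otimes\pi$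 and $\psi_2=B_2\otimes\pi$. $PF^2(k)$ is the set of pairs $(\psi_1,\psi_2)\in PF\times PF$ such that $\psi_1$ and $\psi_2$ are $k$-linked. *)

theory Defs
  imports "Jordan_Normal_Form.Matrix"
begin

section \<open>Quadratic forms up to isometry\<close>

text \<open>
  A quadratic form of dimension \<open>n\<close> over a field is represented by an \<open>n \<times> n\<close> matrix \<open>A\<close>,
  not assumed symmetric, standing for the form \<open>x \<mapsto> x\<^sup>T A x\<close>. In this way one
  obtains every quadratic form in every characteristic. Different matrices can
  represent the same form; they are then isometric via the identity matrix.
\<close>

definition qf_eval :: "'a::field mat \<Rightarrow> 'a vec \<Rightarrow> 'a" where
  "qf_eval A v = v \<bullet> (A *\<^sub>v v)"

definition qf_isometric :: "'a::field mat \<Rightarrow> 'a mat \<Rightarrow> bool"  (infix "\<simeq>\<^sub>q" 50) where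
  "A \<simeq>\<^sub>q B \<longleftrightarrow> (\<exists>n. A \<in> carrier_mat n n \<and> B \<in> carrier_mat n n \<and>
     (\<exists>P \<in> carrier_mat n n. invertible_mat P \<and>
        (\<forall>v \<in> carrier_vec n. qf_eval A (P *\<^sub>v v) = qf_eval B v)))"

definition qf_class :: "'a::field mat \<Rightarrow> 'a mat set" where
  "qf_class A = {B. A \<simeq>\<^sub>q B}"


section \<open>Diagonal bilinear forms and bilinear Pfister forms\<close>

text \<open>
  The diagonal bilinear form \<open>\<langle>b\<^sub>1, \<dots>, b\<^sub>s\<rangle>\<close> is represented by the list of its entries.
\<close>

definition bf_gram :: "'a::field list \<Rightarrow> 'a mat" where
  "bf_gram bs = mat_diag (length bs) (\<lambda>i. bs ! i)"

definition bf_isometric :: "'a::field list \<Rightarrow> 'a list \<Rightarrow> bool"  (infix "\<simeq>\<^sub>b" 50) where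
  "bs \<simeq>\<^sub>b cs \<longleftrightarrow> length bs = length cs \<and>
     (\<exists>P \<in> carrier_mat (length bs) (length bs). invertible_mat P \<and>
        transpose_mat P * bf_gram bs * P = bf_gram cs)"

definition bf_tensor :: "'a::field list \<Rightarrow> 'a list \<Rightarrow> 'a list"  (infixr "\<otimes>\<^sub>b" 75) where
  "bs \<otimes>\<^sub>b cs = concat (map (\<lambda>b. map (\<lambda>c. b * c) cs) bs)"

definition bf_pfister :: "'a::field list \<Rightarrow> 'a list" where
  "bf_pfister as = foldr (\<otimes>\<^sub>b) (map (\<lambda>a. [1, - a]) as) [1]"

definition bilinear_pfister :: "'a::field list \<Rightarrow> bool" where
  "bilinear_pfister bs \<longleftrightarrow> (\<exists>as. 0 \<notin> set as \<and> bs \<simeq>\<^sub>b bf_pfister as)"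

text \<open>\<open>\<langle>b\<^sub>1, \<dots>, b\<^sub>s\<rangle> \<otimes> q = b\<^sub>1 q \<perp> \<cdots> \<perp> b\<^sub>s q\<close>\<close>

definition qf_tensor :: "'a::field list \<Rightarrow> 'a mat \<Rightarrow> 'a mat"  (infixr "\<otimes>\<^sub>q" 75) where
  "bs \<otimes>\<^sub>q A = diag_block_mat (map (\<lambda>b. b \<cdot>\<^sub>m A) bs)"


section \<open>Quadratic Pfister forms\<close>

text \<open>
  The members of \<open>subseqs \<alpha>s\<close> correspond to the exponent vectors \<open>c \<in> {0,1}\<^sup>n\<close>: the sublist
  given by \<open>c\<close> contributes the entry \<open>(-1)\<^bsup>c\<^sub>1 + \<cdots> + c\<^sub>n\<^esup> \<alpha>\<^sub>1\<^bsup>c\<^sub>1\<^esup> \<cdots> \<alpha>\<^sub>n\<^bsup>c\<^sub>n\<^esup>\<close>.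
\<close>

definition qf_pfister :: "'a::field list \<Rightarrow> 'a mat" where
  "qf_pfister \<alpha>s =
     (let ds = map (\<lambda>s. (-1) ^ length s * prod_list s) (subseqs \<alpha>s)
      in mat_diag (length ds) (\<lambda>i. ds ! i))"

text \<open>The form \<open>[1, \<alpha>]\<close>, that is \<open>x\<^sup>2 + x y + \<alpha> y\<^sup>2\<close>.\<close>

definition qf_binary :: "'a::field \<Rightarrow> 'a mat" where
  "qf_binary \<alpha> = mat_of_rows_list 2 [[1, 1], [0, \<alpha>]]"

definition quadratic_pfister :: "nat \<Rightarrow> 'a::field mat \<Rightarrow> bool" where
  "quadratic_pfister n q \<longleftrightarrow> n \<ge> 1 \<and>
     (if CHAR('a) \<noteq> 2
      then \<exists>\<alpha>s. length \<alpha>s = n \<and> 0 \<notin> set \<alpha>s \<and> q \<simeq>\<^sub>q qf_pfister \<alpha>s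
      else \<exists>\<alpha>s \<alpha>. length \<alpha>s = n - 1 \<and> 0 \<notin> set \<alpha>s \<and>
             q \<simeq>\<^sub>q bf_pfister \<alpha>s \<otimes>\<^sub>q qf_binary \<alpha>)"

definition is_quadratic_pfister :: "'a::field mat \<Rightarrow> bool" where
  "is_quadratic_pfister q \<longleftrightarrow> (\<exists>n. quadratic_pfister n q)"

definition linked :: "nat \<Rightarrow> 'a::field mat \<Rightarrow> 'a mat \<Rightarrow> bool" where
  "linked k \<psi>\<^sub>1 \<psi>\<^sub>2 \<longleftrightarrow>
     (\<exists>\<pi> B\<^sub>1 B\<^sub>2. quadratic_pfister k \<pi> \<and> bilinear_pfister B\<^sub>1 \<and> bilinear_pfister B\<^sub>2 \<and>
        \<psi>\<^sub>1 \<simeq>\<^sub>q B\<^sub>1 \<otimes>\<^sub>q \<pi> \<and> \<psi>\<^sub>2 \<simeq>\<^sub>q B\<^sub>2 \<otimes>\<^sub>q \<pi>)"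

definition PF :: "'a::field mat set set" where
  "PF = {qf_class q | q. is_quadratic_pfister q}"

definition PF2 :: "nat \<Rightarrow> ('a::field mat set \<times> 'a mat set) set" where
  "PF2 k = {(qf_class \<psi>\<^sub>1, qf_class \<psi>\<^sub>2) | \<psi>\<^sub>1 \<psi>\<^sub>2.
     is_quadratic_pfister \<psi>\<^sub>1 \<and> is_quadratic_pfister \<psi>\<^sub>2 \<and> linked k \<psi>\<^sub>1 \<psi>\<^sub>2}"

end

theory Submission
  imports Defs "Jordan_Normal_Form.Determinant"
begin

text \<open>
  Write \<open>\<psi>\<^sub>1 = \<phi>\<^sub>1 \<otimes> \<pi> = \<tau>\<^sub>1 \<otimes> \<mu>\<close> and \<open>\<psi>\<^sub>2 = \<phi>\<^sub>2 \<otimes> \<pi> = \<tau>\<^sub>2 \<otimes> \<mu>\<close>. The argument is an induction on the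
  number of bilinear slots whose base case is a computation with Witt cancellation.

  If \<open>\<phi>\<^sub>1 = \<langle>\<langle>a\<rangle>\<rangle>\<close>, \<open>\<phi>\<^sub>2 = \<langle>\<langle>c\<rangle>\<rangle>\<close>, \<open>\<tau>\<^sub>1 = \<langle>\<langle>b\<rangle>\<rangle>\<close> and \<open>\<tau>\<^sub>2 = \<langle>\<langle>d\<rangle>\<rangle>\<close>, then \<open>\<psi>\<^sub>1 - \<psi>\<^sub>2\<close> is, up to
  hyperbolic planes, \<open>-a \<langle>\<langle>ac\<rangle>\<rangle> \<otimes> \<pi>\<close> and also \<open>-b \<langle>\<langle>bd\<rangle>\<rangle> \<otimes> \<mu>\<close>. Pfister forms that are similar
  are isometric, so \<open>\<langle>\<langle>ac\<rangle>\<rangle> \<otimes> \<pi> = \<langle>\<langle>bd\<rangle>\<rangle> \<otimes> \<mu>\<close>. Since \<open>\<langle>\<langle>a, c\<rangle>\<rangle> \<otimes> \<pi> + \<langle>\<langle>ac\<rangle>\<rangle> \<otimes> \<pi>\<close> equals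
  \<open>\<psi>\<^sub>1 + \<psi>\<^sub>2\<close> up to hyperbolic planes, cancellation gives
  \<open>\<langle>\<langle>a, c\<rangle>\<rangle> \<otimes> \<pi> = \<langle>\<langle>b, d\<rangle>\<rangle> \<otimes> \<mu>\<close> (\<open>linked_one_fold_product\<close>).

  If \<open>\<phi>\<^sub>1\<close> has at least two slots and \<open>\<psi>\<^sub>1\<close> is anisotropic, then the complements of \<open>\<pi>\<close> and of
  \<open>\<mu>\<close> in \<open>\<psi>\<^sub>1\<close> are so large that they meet. A value on the intersection can be used as a first slot on
  both sides: \<open>\<psi>\<^sub>1 = \<langle>\<langle>e\<rangle>\<rangle> \<otimes> \<phi>' \<otimes> \<pi> = \<langle>\<langle>e\<rangle>\<rangle> \<otimes> \<tau>' \<otimes> \<mu>\<close> (\<open>common_slot\<close>). Replacing \<open>\<pi>\<close> and \<open>\<mu>\<close> by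
  \<open>\<langle>\<langle>e\<rangle>\<rangle> \<otimes> \<pi>\<close> and \<open>\<langle>\<langle>e\<rangle>\<rangle> \<otimes> \<mu>\<close> removes one slot and leaves the two products unchanged. If \<open>\<psi>\<^sub>1\<close>
  is isotropic, then it absorbs every nonzero scalar, and both products only depend on \<open>\<psi>\<^sub>1\<close> and on
  the number of slots of \<open>\<phi>\<^sub>2\<close> (\<open>pfister_universal\<close>).

  All this takes place in the commutative monoid of isometry classes. The facts about forms that
  it needs hold in every characteristic: Witt cancellation for nonsingular forms
  (\<open>witt_cancellation\<close>), the isometry \<open>uq + vq = (u + v)(q + uvq)\<close> for \<open>u + v \<noteq> 0\<close> (\<open>scaled_pair\<close>), and
  the fact that quadratic Pfister forms are round (\<open>round_double\<close>). The characteristic enters only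
  through the bottom of the Pfister tower: \<open>\<langle>1\<rangle>\<close> if it is not 2, and \<open>[1, \<alpha>]\<close> if it is 2.
\<close>

section \<open>Isometries\<close>

lemma invertible_if_injective:
  fixes P :: "'a::field mat"
  assumes P: "P \<in> carrier_mat n n"
    and inj: "\<And>v. v \<in> carrier_vec n \<Longrightarrow> P *\<^sub>v v = 0\<^sub>v n \<Longrightarrow> v = 0\<^sub>v n"
  shows "invertible_mat P"
proof -
  have "det P \<noteq> 0" using det_0_iff_vec_prod_zero_field[OF P] inj by blast
  from det_non_zero_imp_unit[OF P this, of "()"]
  obtain B where "B \<in> carrier_mat n n" "B * P = 1\<^sub>m n" "P * B = 1\<^sub>m n"
    unfolding Units_def by (auto simp: ring_mat_def)
  then show ?thesis using P unfolding invertible_mat_def inverts_mat_def by auto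
qed

lemma invertible_inverseE:
  fixes P :: "'a::field mat"
  assumes P: "P \<in> carrier_mat n n" and inv: "invertible_mat P"
  obtains R where "R \<in> carrier_mat n n" "R * P = 1\<^sub>m n" "P * R = 1\<^sub>m n"
proof -
  obtain R where R: "inverts_mat P R" "inverts_mat R P"
    using inv unfolding invertible_mat_def by auto
  have "P * R = 1\<^sub>m n" using R(1) P unfolding inverts_mat_def by auto
  moreover from this have "dim_col R = n"
    by (metis index_mult_mat(3) index_one_mat(3))
  moreover have "R * P = 1\<^sub>m (dim_row R)" using R(2) unfolding inverts_mat_def by auto
  moreover from this have "dim_row R = n"
    using P by (metis carrier_matD(2) index_mult_mat(3) index_one_mat(3))
  ultimately show ?thesis using that by auto
qed

lemma mult_mat_zero_vec [simp]:
  "A \<in> carrier_mat nr nc \<Longrightarrow> A *\<^sub>v (0\<^sub>v nc :: 'a::field vec) = 0\<^sub>v nr"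
  by (intro eq_vecI) auto

text \<open>
  For square matrices injectivity already gives invertibility, so an isometry can be exhibited
  without computing its inverse.
\<close>

lemma qf_isometricI:
  fixes A B P :: "'a::field mat"
  assumes "A \<in> carrier_mat n n" "B \<in> carrier_mat n n" "P \<in> carrier_mat n n"
    and "\<And>v. v \<in> carrier_vec n \<Longrightarrow> P *\<^sub>v v = 0\<^sub>v n \<Longrightarrow> v = 0\<^sub>v n"
    and "\<And>v. v \<in> carrier_vec n \<Longrightarrow> qf_eval A (P *\<^sub>v v) = qf_eval B v"
  shows "A \<simeq>\<^sub>q B"
  using assms invertible_if_injective[of P n] unfolding qf_isometric_def by blast

lemma qf_isometricE:
  fixes A B :: "'a::field mat"
  assumes "A \<simeq>\<^sub>q B"
  obtains n P R where "A \<in> carrier_mat n n" "B \<in> carrier_mat n n"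
    "P \<in> carrier_mat n n" "R \<in> carrier_mat n n"
    "\<And>v. v \<in> carrier_vec n \<Longrightarrow> qf_eval A (P *\<^sub>v v) = qf_eval B v"
    "\<And>v. v \<in> carrier_vec n \<Longrightarrow> P *\<^sub>v (R *\<^sub>v v) = v"
    "\<And>v. v \<in> carrier_vec n \<Longrightarrow> R *\<^sub>v (P *\<^sub>v v) = v"
proof -
  obtain n P where *: "A \<in> carrier_mat n n" "B \<in> carrier_mat n n" "P \<in> carrier_mat n n"
    "invertible_mat P" "\<And>v. v \<in> carrier_vec n \<Longrightarrow> qf_eval A (P *\<^sub>v v) = qf_eval B v"
    using assms unfolding qf_isometric_def by blast
  obtain R where R: "R \<in> carrier_mat n n" "R * P = 1\<^sub>m n" "P * R = 1\<^sub>m n"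
    using invertible_inverseE[OF *(3,4)] by blast
  have "P *\<^sub>v (R *\<^sub>v v) = v" "R *\<^sub>v (P *\<^sub>v v) = v" if "v \<in> carrier_vec n" for v
    using that R *(3) by (metis assoc_mult_mat_vec one_mult_mat_vec)+
  with * R that show ?thesis by blast
qed

lemma qf_isometric_refl: "A \<in> carrier_mat n n \<Longrightarrow> A \<simeq>\<^sub>q A"
  by (rule qf_isometricI[of _ n _ "1\<^sub>m n"]) auto

lemma qf_isometric_eqvI:
  assumes "A \<in> carrier_mat n n" "B \<in> carrier_mat n n"
    and "\<And>v. v \<in> carrier_vec n \<Longrightarrow> qf_eval A v = qf_eval B v"
  shows "A \<simeq>\<^sub>q B"
  by (rule qf_isometricI[of _ n _ "1\<^sub>m n"]) (use assms in auto)

lemma qf_isometric_sym: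
  fixes A B :: "'a::field mat"
  assumes "A \<simeq>\<^sub>q B" shows "B \<simeq>\<^sub>q A"
  using assms
proof (rule qf_isometricE)
  fix n P R
  assume *: "A \<in> carrier_mat n n" "B \<in> carrier_mat n n"
    "P \<in> carrier_mat n n" "R \<in> carrier_mat n n"
    "\<And>v. v \<in> carrier_vec n \<Longrightarrow> qf_eval A (P *\<^sub>v v) = qf_eval B v"
    "\<And>v. v \<in> carrier_vec n \<Longrightarrow> P *\<^sub>v (R *\<^sub>v v) = v"
    "\<And>v. v \<in> carrier_vec n \<Longrightarrow> R *\<^sub>v (P *\<^sub>v v) = v"
  show "B \<simeq>\<^sub>q A"
  proof (rule qf_isometricI[of _ n _ R])
    fix v :: "'a vec" assume v: "v \<in> carrier_vec n"
    show "v = 0\<^sub>v n" if "R *\<^sub>v v = 0\<^sub>v n"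
      using *(6)[OF v] *(3) that by auto
    show "qf_eval B (R *\<^sub>v v) = qf_eval A v"
      using *(5)[of "R *\<^sub>v v"] *(6)[OF v] *(4) v by simp
  qed (use * in auto)
qed

lemma qf_isometric_trans:
  fixes A B C :: "'a::field mat"
  assumes "A \<simeq>\<^sub>q B" "B \<simeq>\<^sub>q C" shows "A \<simeq>\<^sub>q C"
proof -
  obtain n P R where *: "A \<in> carrier_mat n n" "B \<in> carrier_mat n n"
    "P \<in> carrier_mat n n" "R \<in> carrier_mat n n"
    "\<And>v. v \<in> carrier_vec n \<Longrightarrow> qf_eval A (P *\<^sub>v v) = qf_eval B v"
    "\<And>v. v \<in> carrier_vec n \<Longrightarrow> R *\<^sub>v (P *\<^sub>v v) = v"
    using assms(1) by (rule qf_isometricE) blast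
  obtain n' P' R' where **: "B \<in> carrier_mat n' n'" "C \<in> carrier_mat n' n'"
    "P' \<in> carrier_mat n' n'" "R' \<in> carrier_mat n' n'"
    "\<And>v. v \<in> carrier_vec n' \<Longrightarrow> qf_eval B (P' *\<^sub>v v) = qf_eval C v"
    "\<And>v. v \<in> carrier_vec n' \<Longrightarrow> R' *\<^sub>v (P' *\<^sub>v v) = v"
    using assms(2) by (rule qf_isometricE) blast
  have [simp]: "n' = n" using * ** by auto
  have PP': "(P * P') *\<^sub>v v = P *\<^sub>v (P' *\<^sub>v v)" if "v \<in> carrier_vec n" for v
    using that * ** by auto
  show ?thesis
  proof (rule qf_isometricI[of _ n _ "P * P'"])
    fix v :: "'a vec" assume v: "v \<in> carrier_vec n"
    then have P'v: "P' *\<^sub>v v \<in> carrier_vec n" using ** by auto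
    show "v = 0\<^sub>v n" if "P * P' *\<^sub>v v = 0\<^sub>v n"
    proof -
      have "P *\<^sub>v (P' *\<^sub>v v) = 0\<^sub>v n" using that PP'[OF v] by simp
      then have "P' *\<^sub>v v = 0\<^sub>v n" using *(6)[OF P'v] *(4) by auto
      then show ?thesis using **(6)[of v] **(4) v by auto
    qed
    show "qf_eval A (P * P' *\<^sub>v v) = qf_eval C v"
      using PP'[OF v] *(5)[OF P'v] **(5)[of v] v by simp
  qed (use * ** in auto)
qed

lemma qf_isometric_carrierD:
  assumes "A \<simeq>\<^sub>q B" and "A \<in> carrier_mat n n"
  shows "B \<in> carrier_mat n n"
  using assms unfolding qf_isometric_def by auto

section \<open>Orthogonal sums\<close>

text \<open>
  The two-block case of \<^const>\<open>diag_block_mat\<close> without an empty last block; this makes it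
  associative as an operation on matrices.
\<close>

definition qf_sum :: "'a::field mat \<Rightarrow> 'a mat \<Rightarrow> 'a mat"  (infixr "\<oplus>\<^sub>q" 65) where
  "A \<oplus>\<^sub>q B = four_block_mat A (0\<^sub>m (dim_row A) (dim_col B)) (0\<^sub>m (dim_row B) (dim_col A)) B"

lemma qf_sum_carrier [simp]:
  "A \<in> carrier_mat n n \<Longrightarrow> B \<in> carrier_mat m m \<Longrightarrow> A \<oplus>\<^sub>q B \<in> carrier_mat (n + m) (n + m)"
  unfolding qf_sum_def by simp

lemma qf_eval_sum:
  assumes "A \<in> carrier_mat n n" "B \<in> carrier_mat m m" "x \<in> carrier_vec n" "y \<in> carrier_vec m"
  shows "qf_eval (A \<oplus>\<^sub>q B) (x @\<^sub>v y) = qf_eval A x + qf_eval B y"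
proof -
  have "(A \<oplus>\<^sub>q B) *\<^sub>v (x @\<^sub>v y) = (A *\<^sub>v x) @\<^sub>v (B *\<^sub>v y)"
    using mult_mat_vec_split[OF assms] assms unfolding qf_sum_def by simp
  then show ?thesis unfolding qf_eval_def
    using scalar_prod_append[of x n y m "A *\<^sub>v x" "B *\<^sub>v y"] assms by simp
qed

lemma carrier_vec_sumE:
  assumes "v \<in> carrier_vec (n + m)"
  obtains x y where "v = x @\<^sub>v y" "x \<in> carrier_vec n" "y \<in> carrier_vec m"
  using vec_first_last_append[OF assms] that by (metis vec_first_carrier vec_last_carrier)

lemma zero_vec_append: "(0\<^sub>v n :: 'a::zero vec) @\<^sub>v 0\<^sub>v m = 0\<^sub>v (n + m)"
  by (intro eq_vecI) auto

lemma append_eq_zero_iff: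
  fixes x y :: "'a::zero vec"
  assumes "x \<in> carrier_vec n"
  shows "x @\<^sub>v y = 0\<^sub>v (n + m) \<longleftrightarrow> x = 0\<^sub>v n \<and> y = 0\<^sub>v m"
  using append_vec_eq[OF assms, of "0\<^sub>v n"] zero_vec_append[of n m] by (metis zero_carrier_vec)

lemma qf_isometric_sumI:
  fixes A B :: "'a::field mat"
  assumes A: "A \<in> carrier_mat (n + m) (n + m)" and B: "B \<in> carrier_mat (n + m) (n + m)"
    and P: "P \<in> carrier_mat (n + m) (n + m)"
    and P_eval: "\<And>x y. x \<in> carrier_vec n \<Longrightarrow> y \<in> carrier_vec m \<Longrightarrow> P *\<^sub>v (x @\<^sub>v y) = f x y"
    and inj: "\<And>x y. x \<in> carrier_vec n \<Longrightarrow> y \<in> carrier_vec m \<Longrightarrow> f x y = 0\<^sub>v (n + m) \<Longrightarrow>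
                 x = 0\<^sub>v n \<and> y = 0\<^sub>v m"
    and eval: "\<And>x y. x \<in> carrier_vec n \<Longrightarrow> y \<in> carrier_vec m \<Longrightarrow>
                 qf_eval A (f x y) = qf_eval B (x @\<^sub>v y)"
  shows "A \<simeq>\<^sub>q B"
proof (rule qf_isometricI[OF A B P])
  fix v :: "'a vec" assume "v \<in> carrier_vec (n + m)"
  then obtain x y where v: "v = x @\<^sub>v y" "x \<in> carrier_vec n" "y \<in> carrier_vec m"
    by (rule carrier_vec_sumE)
  show "v = 0\<^sub>v (n + m)" if "P *\<^sub>v v = 0\<^sub>v (n + m)"
    using inj[OF v(2,3)] that v P_eval[OF v(2,3)] zero_vec_append by simp
  show "qf_eval A (P *\<^sub>v v) = qf_eval B v"
    using eval[OF v(2,3)] P_eval[OF v(2,3)] v(1) by simp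
qed

lemma qf_sum_cong:
  fixes A B :: "'a::field mat"
  assumes "A \<simeq>\<^sub>q A'" "B \<simeq>\<^sub>q B'"
  shows "A \<oplus>\<^sub>q B \<simeq>\<^sub>q A' \<oplus>\<^sub>q B'"
proof -
  obtain n P R where *: "A \<in> carrier_mat n n" "A' \<in> carrier_mat n n"
    "P \<in> carrier_mat n n" "R \<in> carrier_mat n n"
    "\<And>v. v \<in> carrier_vec n \<Longrightarrow> qf_eval A (P *\<^sub>v v) = qf_eval A' v"
    "\<And>v. v \<in> carrier_vec n \<Longrightarrow> R *\<^sub>v (P *\<^sub>v v) = v"
    using assms(1) by (rule qf_isometricE) blast
  obtain m P' R' where **: "B \<in> carrier_mat m m" "B' \<in> carrier_mat m m"
    "P' \<in> carrier_mat m m" "R' \<in> carrier_mat m m"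
    "\<And>v. v \<in> carrier_vec m \<Longrightarrow> qf_eval B (P' *\<^sub>v v) = qf_eval B' v"
    "\<And>v. v \<in> carrier_vec m \<Longrightarrow> R' *\<^sub>v (P' *\<^sub>v v) = v"
    using assms(2) by (rule qf_isometricE) blast
  show ?thesis
  proof (rule qf_isometric_sumI[where n = n and m = m and
        P = "four_block_mat P (0\<^sub>m n m) (0\<^sub>m m n) P'" and f = "\<lambda>x y. (P *\<^sub>v x) @\<^sub>v (P' *\<^sub>v y)"])
    fix x y :: "'a vec" assume xy: "x \<in> carrier_vec n" "y \<in> carrier_vec m"
    show "four_block_mat P (0\<^sub>m n m) (0\<^sub>m m n) P' *\<^sub>v (x @\<^sub>v y) = (P *\<^sub>v x) @\<^sub>v (P' *\<^sub>v y)"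
      using mult_mat_vec_split *(3) **(3) xy by blast
    show "x = 0\<^sub>v n \<and> y = 0\<^sub>v m" if "(P *\<^sub>v x) @\<^sub>v (P' *\<^sub>v y) = 0\<^sub>v (n + m)"
    proof -
      have "P *\<^sub>v x = 0\<^sub>v n \<and> P' *\<^sub>v y = 0\<^sub>v m"
        using that append_eq_zero_iff *(3) xy by (metis mult_mat_vec_carrier)
      then show ?thesis using *(6)[OF xy(1)] **(6)[OF xy(2)] *(4) **(4) by auto
    qed
    show "qf_eval (A \<oplus>\<^sub>q B) ((P *\<^sub>v x) @\<^sub>v (P' *\<^sub>v y)) = qf_eval (A' \<oplus>\<^sub>q B') (x @\<^sub>v y)"
      using * ** xy by (simp add: qf_eval_sum[where n = n and m = m])
  qed (use * ** in auto)
qed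

lemma qf_sum_commute:
  assumes A: "A \<in> carrier_mat n n" and B: "B \<in> carrier_mat m m"
  shows "A \<oplus>\<^sub>q B \<simeq>\<^sub>q B \<oplus>\<^sub>q (A :: 'a::field mat)"
proof (rule qf_isometric_sumI[where n = m and m = n and
      P = "four_block_mat (0\<^sub>m n m) (1\<^sub>m n) (1\<^sub>m m) (0\<^sub>m m n)" and f = "\<lambda>x y. y @\<^sub>v x"])
  show "A \<oplus>\<^sub>q B \<in> carrier_mat (m + n) (m + n)" using qf_sum_carrier[OF A B] by (simp add: add.commute)
  show "B \<oplus>\<^sub>q A \<in> carrier_mat (m + n) (m + n)" using qf_sum_carrier[OF B A] .
  show "four_block_mat (0\<^sub>m n m) (1\<^sub>m n) (1\<^sub>m m) (0\<^sub>m m n :: 'a mat) \<in> carrier_mat (m + n) (m + n)"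
    using four_block_carrier_mat[of "0\<^sub>m n m" n m "0\<^sub>m m n" m n] by (simp add: add.commute)
  fix x y :: "'a vec" assume xy: "x \<in> carrier_vec m" "y \<in> carrier_vec n"
  show "four_block_mat (0\<^sub>m n m) (1\<^sub>m n) (1\<^sub>m m) (0\<^sub>m m n) *\<^sub>v (x @\<^sub>v y) = y @\<^sub>v x"
    using xy by (subst four_block_mat_mult_vec[of _ n m _ n _ m]) auto
  show "x = 0\<^sub>v m \<and> y = 0\<^sub>v n" if "y @\<^sub>v x = 0\<^sub>v (m + n)"
    using that append_eq_zero_iff[OF xy(2), of x m] by (simp add: add.commute)
  show "qf_eval (A \<oplus>\<^sub>q B) (y @\<^sub>v x) = qf_eval (B \<oplus>\<^sub>q A) (x @\<^sub>v y)"
    using A B xy by (simp add: qf_eval_sum[where n = n and m = m] qf_eval_sum[where n = m and m = n])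
qed

lemma qf_sum_assoc: "(A \<oplus>\<^sub>q B) \<oplus>\<^sub>q C = A \<oplus>\<^sub>q (B \<oplus>\<^sub>q C)"
  unfolding qf_sum_def using assoc_four_block_mat[of A B C] by simp

lemma qf_sum_zero_left: "0\<^sub>m 0 0 \<oplus>\<^sub>q A = A"
  unfolding qf_sum_def by (intro eq_matI) auto

lemma qf_smult_sum:
  "A \<in> carrier_mat n n \<Longrightarrow> B \<in> carrier_mat m m \<Longrightarrow> c \<cdot>\<^sub>m (A \<oplus>\<^sub>q B) = (c \<cdot>\<^sub>m A) \<oplus>\<^sub>q (c \<cdot>\<^sub>m B)"
  unfolding qf_sum_def by (intro eq_matI) auto

lemma qf_eval_smult:
  assumes "A \<in> carrier_mat n n" "v \<in> carrier_vec n"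
  shows "qf_eval (c \<cdot>\<^sub>m A) v = c * qf_eval A v"
proof -
  have "(c \<cdot>\<^sub>m A) *\<^sub>v v = c \<cdot>\<^sub>v (A *\<^sub>v v)"
    using assms by (intro eq_vecI) (auto simp: row_smult)
  then show ?thesis unfolding qf_eval_def
    using scalar_prod_smult_distrib[of v n "A *\<^sub>v v" c] assms by simp
qed

lemma qf_smult_cong:
  fixes A B :: "'a::field mat"
  assumes "A \<simeq>\<^sub>q B" shows "c \<cdot>\<^sub>m A \<simeq>\<^sub>q c \<cdot>\<^sub>m B"
  using assms
proof (rule qf_isometricE)
  fix n P R
  assume *: "A \<in> carrier_mat n n" "B \<in> carrier_mat n n"
    "P \<in> carrier_mat n n" "R \<in> carrier_mat n n"
    "\<And>v. v \<in> carrier_vec n \<Longrightarrow> qf_eval A (P *\<^sub>v v) = qf_eval B v"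
    "\<And>v. v \<in> carrier_vec n \<Longrightarrow> R *\<^sub>v (P *\<^sub>v v) = v"
  show ?thesis
  proof (rule qf_isometricI[of _ n _ P])
    fix v :: "'a vec" assume v: "v \<in> carrier_vec n"
    show "v = 0\<^sub>v n" if "P *\<^sub>v v = 0\<^sub>v n" using *(6)[OF v] *(4) that by auto
    show "qf_eval (c \<cdot>\<^sub>m A) (P *\<^sub>v v) = qf_eval (c \<cdot>\<^sub>m B) v"
      using * v by (simp add: qf_eval_smult[where n = n])
  qed (use * in auto)
qed

section \<open>Polar forms and nonsingularity\<close>

lemma smult_mat_mult_vec:
  "A \<in> carrier_mat nr nc \<Longrightarrow> v \<in> carrier_vec nc \<Longrightarrow> (c \<cdot>\<^sub>m A) *\<^sub>v v = c \<cdot>\<^sub>v (A *\<^sub>v (v :: 'a::field vec))"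
  by (intro eq_vecI) (auto simp: row_smult)

text \<open>
  The polar form \<open>Q(u + v) - Q(u) - Q(v)\<close>. Its matrix is \<open>A + A\<^sup>T\<close>, because \<open>A\<close> need not be
  symmetric.
\<close>

definition qf_polar :: "'a::field mat \<Rightarrow> 'a vec \<Rightarrow> 'a vec \<Rightarrow> 'a" where
  "qf_polar A u v = u \<bullet> (A *\<^sub>v v) + v \<bullet> (A *\<^sub>v u)"

context
  fixes A :: "'a::field mat" and n :: nat
  assumes A: "A \<in> carrier_mat n n"
begin

lemma qf_eval_add:
  assumes "u \<in> carrier_vec n" "v \<in> carrier_vec n"
  shows "qf_eval A (u + v) = qf_eval A u + qf_eval A v + qf_polar A u v"
  using A assms unfolding qf_eval_def qf_polar_def
  by (simp add: mult_add_distrib_mat_vec[of _ n n] scalar_prod_add_distrib[of _ n]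
      add_scalar_prod_distrib[of _ n])

lemma qf_eval_smult_vec:
  assumes "u \<in> carrier_vec n"
  shows "qf_eval A (c \<cdot>\<^sub>v u) = c * c * qf_eval A u"
  using A assms unfolding qf_eval_def
  by (simp add: mult_mat_vec[of _ n n] smult_scalar_prod_distrib[of _ n]
      scalar_prod_smult_distrib[of _ n] mult.assoc)

lemma qf_eval_zero: "qf_eval A (0\<^sub>v n) = 0"
  using A unfolding qf_eval_def by simp

lemma qf_polar_commute: "qf_polar A u v = qf_polar A v u"
  unfolding qf_polar_def by (rule add.commute)

lemma qf_polar_add:
  assumes "u \<in> carrier_vec n" "v \<in> carrier_vec n" "w \<in> carrier_vec n"
  shows "qf_polar A (u + v) w = qf_polar A u w + qf_polar A v w"
  using A assms unfolding qf_polar_def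
  by (simp add: mult_add_distrib_mat_vec[of _ n n] scalar_prod_add_distrib[of _ n]
      add_scalar_prod_distrib[of _ n])

lemma qf_polar_smult:
  assumes "u \<in> carrier_vec n" "v \<in> carrier_vec n"
  shows "qf_polar A (c \<cdot>\<^sub>v u) v = c * qf_polar A u v"
  using A assms unfolding qf_polar_def
  by (simp add: mult_mat_vec[of _ n n] smult_scalar_prod_distrib[of _ n]
      scalar_prod_smult_distrib[of _ n] distrib_left)

lemma qf_polar_smult_right:
  assumes "u \<in> carrier_vec n" "v \<in> carrier_vec n"
  shows "qf_polar A u (c \<cdot>\<^sub>v v) = c * qf_polar A u v"
  using qf_polar_smult[OF assms(2,1), of c] by (simp add: qf_polar_commute)

lemma qf_polar_add_right:
  assumes "u \<in> carrier_vec n" "v \<in> carrier_vec n" "w \<in> carrier_vec n"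
  shows "qf_polar A u (v + w) = qf_polar A u v + qf_polar A u w"
  using qf_polar_add[OF assms(2,3,1)] by (simp add: qf_polar_commute)

lemma qf_polar_self: "u \<in> carrier_vec n \<Longrightarrow> qf_polar A u u = 2 * qf_eval A u"
  unfolding qf_polar_def qf_eval_def by simp

lemma qf_polar_transpose:
  assumes "u \<in> carrier_vec n" "v \<in> carrier_vec n"
  shows "qf_polar A u v = (A *\<^sub>v u + A\<^sup>T *\<^sub>v u) \<bullet> v"
proof -
  have "u \<bullet> (A *\<^sub>v v) = (A\<^sup>T *\<^sub>v u) \<bullet> v"
    using transpose_vec_mult_scalar[OF A assms(2,1)] by simp
  moreover have "v \<bullet> (A *\<^sub>v u) = (A *\<^sub>v u) \<bullet> v"
    using comm_scalar_prod[OF assms(2), of "A *\<^sub>v u"] A assms by simp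
  ultimately show ?thesis
    unfolding qf_polar_def using A assms add_scalar_prod_distrib[of "A *\<^sub>v u" n "A\<^sup>T *\<^sub>v u" v]
    by (simp add: add.commute)
qed

end

lemma qf_polar_sum:
  assumes "A \<in> carrier_mat n n" "B \<in> carrier_mat m m"
    "x \<in> carrier_vec n" "y \<in> carrier_vec m" "x' \<in> carrier_vec n" "y' \<in> carrier_vec m"
  shows "qf_polar (A \<oplus>\<^sub>q B) (x @\<^sub>v y) (x' @\<^sub>v y') = qf_polar A x x' + qf_polar B y y'"
proof -
  have AB: "A \<oplus>\<^sub>q B \<in> carrier_mat (n + m) (n + m)" using assms by simp
  have "qf_eval (A \<oplus>\<^sub>q B) ((x @\<^sub>v y) + (x' @\<^sub>v y')) = qf_eval A (x + x') + qf_eval B (y + y')"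
    using assms by (simp add: append_vec_add[of _ n _ _ m] qf_eval_sum[where n = n and m = m])
  moreover have "qf_eval (A \<oplus>\<^sub>q B) ((x @\<^sub>v y) + (x' @\<^sub>v y')) = qf_eval A x + qf_eval B y +
      (qf_eval A x' + qf_eval B y') + qf_polar (A \<oplus>\<^sub>q B) (x @\<^sub>v y) (x' @\<^sub>v y')"
    using assms qf_eval_add[OF AB, of "x @\<^sub>v y" "x' @\<^sub>v y'"]
    by (simp add: qf_eval_sum[where n = n and m = m])
  ultimately show ?thesis
    using qf_eval_add[OF assms(1), of x x'] qf_eval_add[OF assms(2), of y y'] assms
    by (simp add: algebra_simps)
qed

definition qf_nonsingular :: "'a::field mat \<Rightarrow> bool" where
  "qf_nonsingular A \<longleftrightarrow> (\<forall>u \<in> carrier_vec (dim_row A).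
     (\<forall>v \<in> carrier_vec (dim_row A). qf_polar A u v = 0) \<longrightarrow> u = 0\<^sub>v (dim_row A))"

lemma qf_nonsingularD:
  assumes "qf_nonsingular A" "A \<in> carrier_mat n n" "u \<in> carrier_vec n"
    "\<And>v. v \<in> carrier_vec n \<Longrightarrow> qf_polar A u v = 0"
  shows "u = 0\<^sub>v n"
  using assms unfolding qf_nonsingular_def by auto

lemma qf_polar_isometry:
  assumes "A \<in> carrier_mat n n" "B \<in> carrier_mat n n" "P \<in> carrier_mat n n"
    "\<And>v. v \<in> carrier_vec n \<Longrightarrow> qf_eval A (P *\<^sub>v v) = qf_eval B v"
    "u \<in> carrier_vec n" "v \<in> carrier_vec n"
  shows "qf_polar A (P *\<^sub>v u) (P *\<^sub>v v) = qf_polar B u v"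
proof -
  have "qf_eval A (P *\<^sub>v u + P *\<^sub>v v) = qf_eval B (u + v)"
    using assms by (simp add: mult_add_distrib_mat_vec[of _ n n, symmetric])
  then show ?thesis
    using qf_eval_add[OF assms(1), of "P *\<^sub>v u" "P *\<^sub>v v"] qf_eval_add[OF assms(2), of u v] assms
    by simp
qed

lemma qf_nonsingular_cong:
  fixes A B :: "'a::field mat"
  assumes "A \<simeq>\<^sub>q B" "qf_nonsingular A"
  shows "qf_nonsingular B"
  using assms(1)
proof (rule qf_isometricE)
  fix n P R
  assume *: "A \<in> carrier_mat n n" "B \<in> carrier_mat n n"
    "P \<in> carrier_mat n n" "R \<in> carrier_mat n n"
    "\<And>v. v \<in> carrier_vec n \<Longrightarrow> qf_eval A (P *\<^sub>v v) = qf_eval B v"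
    "\<And>v. v \<in> carrier_vec n \<Longrightarrow> P *\<^sub>v (R *\<^sub>v v) = v"
    "\<And>v. v \<in> carrier_vec n \<Longrightarrow> R *\<^sub>v (P *\<^sub>v v) = v"
  have "u = 0\<^sub>v n" if u: "u \<in> carrier_vec n"
    and rad: "\<And>v. v \<in> carrier_vec n \<Longrightarrow> qf_polar B u v = 0" for u
  proof -
    have "qf_polar A (P *\<^sub>v u) v = 0" if v: "v \<in> carrier_vec n" for v
      using qf_polar_isometry[OF *(1-3,5) u, of "R *\<^sub>v v"] rad[of "R *\<^sub>v v"] *(4) *(6)[OF v] v
      by simp
    then have "P *\<^sub>v u = 0\<^sub>v n" using qf_nonsingularD[OF assms(2) *(1)] *(3) u by simp
    then show ?thesis using *(7)[OF u] *(4) by simp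
  qed
  then show ?thesis using * unfolding qf_nonsingular_def by auto
qed

lemma qf_nonsingular_sum:
  fixes A B :: "'a::field mat"
  assumes A: "A \<in> carrier_mat n n" "qf_nonsingular A"
    and B: "B \<in> carrier_mat m m" "qf_nonsingular B"
  shows "qf_nonsingular (A \<oplus>\<^sub>q B)"
proof -
  have AB: "A \<oplus>\<^sub>q B \<in> carrier_mat (n + m) (n + m)" using A B by simp
  have "u = 0\<^sub>v (n + m)" if u: "u \<in> carrier_vec (n + m)"
    and rad: "\<And>v. v \<in> carrier_vec (n + m) \<Longrightarrow> qf_polar (A \<oplus>\<^sub>q B) u v = 0" for u
  proof -
    obtain x y where xy: "u = x @\<^sub>v y" "x \<in> carrier_vec n" "y \<in> carrier_vec m"
      using u by (rule carrier_vec_sumE)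
    have "qf_polar A x x' = 0" if x': "x' \<in> carrier_vec n" for x'
      using rad[of "x' @\<^sub>v 0\<^sub>v m"] qf_polar_sum[OF A(1) B(1) xy(2,3) x', of "0\<^sub>v m"] x' xy B
      by (simp add: qf_polar_def)
    then have "x = 0\<^sub>v n" using qf_nonsingularD A xy by blast
    have "qf_polar B y y' = 0" if y': "y' \<in> carrier_vec m" for y'
      using rad[of "0\<^sub>v n @\<^sub>v y'"] qf_polar_sum[OF A(1) B(1) xy(2,3) _ y', of "0\<^sub>v n"] y' xy A
      by (simp add: qf_polar_def)
    then have "y = 0\<^sub>v m" using qf_nonsingularD B xy by blast
    with \<open>x = 0\<^sub>v n\<close> xy show ?thesis by (simp add: zero_vec_append)
  qed
  then show ?thesis using AB unfolding qf_nonsingular_def by auto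
qed

lemma qf_polar_smult_mat:
  assumes "A \<in> carrier_mat n n" "u \<in> carrier_vec n" "v \<in> carrier_vec n"
  shows "qf_polar (c \<cdot>\<^sub>m A) u v = c * qf_polar A u v"
  using assms unfolding qf_polar_def
  by (simp add: smult_mat_mult_vec[of _ n n] scalar_prod_smult_distrib[of _ n] distrib_left)

lemma qf_nonsingular_smult:
  fixes A :: "'a::field mat"
  assumes "A \<in> carrier_mat n n" "qf_nonsingular A" "c \<noteq> 0"
  shows "qf_nonsingular (c \<cdot>\<^sub>m A)"
  using assms unfolding qf_nonsingular_def by (auto simp: qf_polar_smult_mat[of _ n])

section \<open>Explicit isometries\<close>

lemma vec_diff_eq_zero:
  fixes x y :: "'a::field vec"
  assumes "x \<in> carrier_vec n" "y \<in> carrier_vec n" "x - y = 0\<^sub>v n"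
  shows "x = y"
proof (rule eq_vecI)
  fix i assume i: "i < dim_vec y"
  have "(x - y) $ i = 0" using assms(2,3) i by simp
  moreover have "(x - y) $ i = x $ i - y $ i" using i by (rule index_minus_vec(1))
  ultimately show "x $ i = y $ i" by simp
qed (use assms in auto)

text \<open>
  The scalar matrix \<open>c\<close> is an isometry from \<open>c\<^sup>2 Q\<close> to \<open>Q\<close>.
\<close>

lemma qf_smult_square:
  assumes A: "A \<in> carrier_mat n n" and c: "c \<noteq> (0::'a::field)"
  shows "(c * c) \<cdot>\<^sub>m A \<simeq>\<^sub>q A"
proof (rule qf_isometric_sym, rule qf_isometricI[of _ n _ "c \<cdot>\<^sub>m 1\<^sub>m n"])
  fix v :: "'a vec" assume v: "v \<in> carrier_vec n"
  have [simp]: "(c \<cdot>\<^sub>m 1\<^sub>m n) *\<^sub>v v = c \<cdot>\<^sub>v v" using v by (simp add: smult_mat_mult_vec[of _ n n])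
  show "v = 0\<^sub>v n" if "(c \<cdot>\<^sub>m 1\<^sub>m n) *\<^sub>v v = 0\<^sub>v n"
  proof -
    have "c * v $ i = 0" if "i < n" for i
      using \<open>(c \<cdot>\<^sub>m 1\<^sub>m n) *\<^sub>v v = 0\<^sub>v n\<close>[THEN arg_cong, of "\<lambda>w. w $ i"] that v by simp
    then show ?thesis using c v by (intro eq_vecI) auto
  qed
  show "qf_eval A ((c \<cdot>\<^sub>m 1\<^sub>m n) *\<^sub>v v) = qf_eval ((c * c) \<cdot>\<^sub>m A) v"
    using A v by (simp add: qf_eval_smult_vec[of _ n] qf_eval_smult[of _ n])
qed (use A in auto)

text \<open>
  The map \<open>(x, y) \<mapsto> (x + v y, x - u y)\<close>: in \<open>u Q(x + v y) + v Q(x - u y)\<close> the two polar terms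
  \<open>\<plusminus>uv b(x, y)\<close> cancel. It is injective because the difference of its components is \<open>(u + v) y\<close>.
\<close>

lemma qf_scaled_pair:
  fixes A :: "'a::field mat"
  assumes A: "A \<in> carrier_mat n n" and uv: "u + v \<noteq> 0"
  shows "(u \<cdot>\<^sub>m A) \<oplus>\<^sub>q (v \<cdot>\<^sub>m A) \<simeq>\<^sub>q ((u + v) \<cdot>\<^sub>m A) \<oplus>\<^sub>q (((u + v) * (u * v)) \<cdot>\<^sub>m A)"
proof (rule qf_isometric_sumI[where n = n and m = n and
      P = "four_block_mat (1\<^sub>m n) (v \<cdot>\<^sub>m 1\<^sub>m n) (1\<^sub>m n) ((- u) \<cdot>\<^sub>m 1\<^sub>m n)" and
      f = "\<lambda>x y. (x + v \<cdot>\<^sub>v y) @\<^sub>v (x + (- u) \<cdot>\<^sub>v y)"])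
  fix x y :: "'a vec" assume xy: "x \<in> carrier_vec n" "y \<in> carrier_vec n"
  show "four_block_mat (1\<^sub>m n) (v \<cdot>\<^sub>m 1\<^sub>m n) (1\<^sub>m n) ((- u) \<cdot>\<^sub>m 1\<^sub>m n) *\<^sub>v (x @\<^sub>v y) =
      (x + v \<cdot>\<^sub>v y) @\<^sub>v (x + (- u) \<cdot>\<^sub>v y)"
    using xy by (subst four_block_mat_mult_vec[of _ n n _ n _ n]) (auto simp: smult_mat_mult_vec[of _ n n])
  show "x = 0\<^sub>v n \<and> y = 0\<^sub>v n" if "(x + v \<cdot>\<^sub>v y) @\<^sub>v (x + (- u) \<cdot>\<^sub>v y) = 0\<^sub>v (n + n)"
  proof -
    have 0: "x + v \<cdot>\<^sub>v y = 0\<^sub>v n" "x + (- u) \<cdot>\<^sub>v y = 0\<^sub>v n"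
      using that xy append_eq_zero_iff[of "x + v \<cdot>\<^sub>v y" n "x + (- u) \<cdot>\<^sub>v y" n] by auto
    have "y $ i = 0 \<and> x $ i = 0" if i: "i < n" for i
    proof -
      have 1: "x $ i + v * y $ i = 0" "x $ i - u * y $ i = 0"
        using 0[THEN arg_cong, of "\<lambda>z. z $ i"] i xy by auto
      then have "(u + v) * y $ i = 0" by (simp add: algebra_simps) 
      then show ?thesis using uv 1 by auto
    qed
    then show ?thesis using xy by (auto intro!: eq_vecI)
  qed
  show "qf_eval ((u \<cdot>\<^sub>m A) \<oplus>\<^sub>q (v \<cdot>\<^sub>m A)) ((x + v \<cdot>\<^sub>v y) @\<^sub>v (x + (- u) \<cdot>\<^sub>v y)) =
      qf_eval (((u + v) \<cdot>\<^sub>m A) \<oplus>\<^sub>q (((u + v) * (u * v)) \<cdot>\<^sub>m A)) (x @\<^sub>v y)"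
    using A xy
    by (simp add: qf_eval_sum[where n = n and m = n] qf_eval_smult[of _ n] qf_eval_add[of _ n]
        qf_eval_smult_vec[of _ n] qf_polar_smult_mat[of _ n] qf_polar_smult_right[of _ n] algebra_simps)
qed (use A in auto)

text \<open>
  The form \<open>(x, y) \<mapsto> x \<bullet> y\<close>, a sum of \<open>n\<close> hyperbolic planes.
\<close>

definition hyperbolic_mat :: "nat \<Rightarrow> 'a::field mat" where
  "hyperbolic_mat n = four_block_mat (0\<^sub>m n n) (1\<^sub>m n) (0\<^sub>m n n) (0\<^sub>m n n)"

lemma hyperbolic_mat_carrier [simp]: "hyperbolic_mat n \<in> carrier_mat (n + n) (n + n)"
  unfolding hyperbolic_mat_def by simp

lemma qf_eval_hyperbolic:
  assumes "x \<in> carrier_vec n" "y \<in> carrier_vec n"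
  shows "qf_eval (hyperbolic_mat n) (x @\<^sub>v y) = x \<bullet> (y :: 'a::field vec)"
proof -
  have "hyperbolic_mat n *\<^sub>v (x @\<^sub>v y) = y @\<^sub>v 0\<^sub>v n"
    using assms unfolding hyperbolic_mat_def
    by (subst four_block_mat_mult_vec[of _ n n _ n _ n]) auto
  then show ?thesis
    using assms scalar_prod_append[of x n y n y "0\<^sub>v n"] unfolding qf_eval_def by simp
qed

text \<open>
  This rests on the identity \<open>Q(x) - Q(y) = (x - y) \<bullet> (A x + A\<^sup>T y)\<close>. A vector in the kernel of
  \<open>(x, y) \<mapsto> (x - y, A x + A\<^sup>T y)\<close> has \<open>x = y\<close> and \<open>(A + A\<^sup>T) x = 0\<close>, that is, \<open>x\<close> lies in the
  radical of the polar form.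
\<close>

lemma qf_sum_negative_hyperbolic:
  fixes A :: "'a::field mat"
  assumes A: "A \<in> carrier_mat n n" and ns: "qf_nonsingular A"
  shows "A \<oplus>\<^sub>q ((- 1) \<cdot>\<^sub>m A) \<simeq>\<^sub>q hyperbolic_mat n"
proof (rule qf_isometric_sym, rule qf_isometric_sumI[where n = n and m = n and
      P = "four_block_mat (1\<^sub>m n) (- 1\<^sub>m n) A A\<^sup>T" and
      f = "\<lambda>x y. (x - y) @\<^sub>v (A *\<^sub>v x + A\<^sup>T *\<^sub>v y)"])
  fix x y :: "'a vec" assume xy: "x \<in> carrier_vec n" "y \<in> carrier_vec n"
  show "four_block_mat (1\<^sub>m n) (- 1\<^sub>m n) A A\<^sup>T *\<^sub>v (x @\<^sub>v y) = (x - y) @\<^sub>v (A *\<^sub>v x + A\<^sup>T *\<^sub>v y)"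
    using A xy by (subst four_block_mat_mult_vec[of _ n n _ n _ n])
      (auto simp: uminus_mult_mat_vec minus_add_uminus_vec[of _ n])
  show "x = 0\<^sub>v n \<and> y = 0\<^sub>v n" if "(x - y) @\<^sub>v (A *\<^sub>v x + A\<^sup>T *\<^sub>v y) = 0\<^sub>v (n + n)"
  proof -
    have 0: "x - y = 0\<^sub>v n" "A *\<^sub>v x + A\<^sup>T *\<^sub>v y = 0\<^sub>v n"
      using that A xy append_eq_zero_iff[of "x - y" n "A *\<^sub>v x + A\<^sup>T *\<^sub>v y" n] by auto
    have "x = y" using 0(1) xy by (rule vec_diff_eq_zero[rotated 2])
    then have "qf_polar A x v = 0" if "v \<in> carrier_vec n" for v
      using qf_polar_transpose[OF A xy(1) that] 0(2) that by simp
    then have "x = 0\<^sub>v n" using qf_nonsingularD[OF ns A xy(1)] by blast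
    then show ?thesis using \<open>x = y\<close> by simp
  qed
  show "qf_eval (hyperbolic_mat n) ((x - y) @\<^sub>v (A *\<^sub>v x + A\<^sup>T *\<^sub>v y)) =
      qf_eval (A \<oplus>\<^sub>q ((- 1) \<cdot>\<^sub>m A)) (x @\<^sub>v y)"
  proof -
    have t: "z \<bullet> (A\<^sup>T *\<^sub>v y) = y \<bullet> (A *\<^sub>v z)" if z: "z \<in> carrier_vec n" for z
      using transpose_vec_mult_scalar[OF A z xy(2)] comm_scalar_prod[OF z, of "A\<^sup>T *\<^sub>v y"] A xy
      by simp
    show ?thesis using A xy
      by (simp add: qf_eval_hyperbolic qf_eval_sum[where n = n and m = n] qf_eval_smult[of _ n]
          scalar_prod_add_distrib[of _ n] minus_scalar_prod_distrib[of _ n] t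
          mult_minus_distrib_mat_vec[of _ n n] scalar_prod_minus_distrib[of _ n])
        (simp add: qf_eval_def)
  qed
qed (use A in auto)

text \<open>
  A permutation of the coordinates that moves the first hyperbolic pair, at the positions \<open>0\<close> and
  \<open>n + 1\<close>, to the front.
\<close>

lemma hyperbolic_mat_Suc:
  "hyperbolic_mat 1 \<oplus>\<^sub>q hyperbolic_mat n \<simeq>\<^sub>q (hyperbolic_mat (Suc n) :: 'a::field mat)"
proof -
  define \<sigma> where "\<sigma> i = (if i = 0 then 0 else if i = 1 then Suc n
      else if i < 2 + n then i - 1 else i)" for i
  define P :: "'a mat" where "P = mat (2 + (n + n)) (2 + (n + n)) (\<lambda>(i, j). if j = \<sigma> i then 1 else 0)"
  have \<sigma>: "\<sigma> i < 2 + (n + n)" if "i < 2 + (n + n)" for i using that unfolding \<sigma>_def by auto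
  have P_index: "(P *\<^sub>v v) $ i = v $ \<sigma> i"
    if "v \<in> carrier_vec (2 + (n + n))" "i < 2 + (n + n)" for v i
  proof -
    have "(P *\<^sub>v v) $ i = (\<Sum>j = 0..<2 + (n + n). (if j = \<sigma> i then 1 else 0) * v $ j)"
      using that unfolding P_def by (auto simp: scalar_prod_def intro!: sum.cong)
    also have "\<dots> = (\<Sum>j = 0..<2 + (n + n). if j = \<sigma> i then v $ j else 0)"
      by (rule sum.cong) auto
    finally show ?thesis using \<sigma>[OF that(2)] by simp
  qed
  have P_car: "P \<in> carrier_mat (2 + (n + n)) (2 + (n + n))" unfolding P_def by simp
  show ?thesis
  proof (rule qf_isometricI[OF _ _ P_car])
    fix v :: "'a vec" assume v: "v \<in> carrier_vec (2 + (n + n))"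
    show "v = 0\<^sub>v (2 + (n + n))" if "P *\<^sub>v v = 0\<^sub>v (2 + (n + n))"
    proof (rule eq_vecI)
      fix j assume "j < dim_vec (0\<^sub>v (2 + (n + n)) :: 'a vec)"
      then have j: "j < 2 + (n + n)" by simp
      define i where "i = (if j = 0 then 0 else if j = Suc n then 1 else if j < Suc n then j + 1 else j)"
      have "i < 2 + (n + n)" "\<sigma> i = j" using j unfolding i_def \<sigma>_def by auto
      then show "v $ j = 0\<^sub>v (2 + (n + n)) $ j" using P_index[OF v] that j by (metis index_zero_vec(1))
    qed (use v in simp)
    define a b where "a = vec 1 (\<lambda>_. v $ 0)" and "b = vec 1 (\<lambda>_. v $ Suc n)"
    define x y where "x = vec n (\<lambda>i. v $ (1 + i))" and "y = vec n (\<lambda>i. v $ (2 + n + i))"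
    have Pv: "P *\<^sub>v v = (a @\<^sub>v b) @\<^sub>v (x @\<^sub>v y)"
    proof (rule eq_vecI)
      fix i assume "i < dim_vec ((a @\<^sub>v b) @\<^sub>v (x @\<^sub>v y))"
      then have i: "i < 2 + (n + n)" by (simp add: a_def b_def x_def y_def)
      show "(P *\<^sub>v v) $ i = ((a @\<^sub>v b) @\<^sub>v (x @\<^sub>v y)) $ i"
        unfolding P_index[OF v i] \<sigma>_def using i
        by (auto simp: a_def b_def x_def y_def Suc_diff_Suc numeral_2_eq_2 not_less intro!: arg_cong[of _ _ "\<lambda>i. v $ i"])
    qed (use P_car in \<open>simp add: a_def b_def x_def y_def\<close>)
    have v': "v = vCons (v $ 0) x @\<^sub>v vCons (v $ Suc n) y"
      using v by (intro eq_vecI) (auto simp: x_def y_def vec_index_vCons numeral_2_eq_2 not_less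
          intro!: arg_cong[of _ _ "\<lambda>i. v $ i"])
    have "qf_eval (hyperbolic_mat 1 \<oplus>\<^sub>q hyperbolic_mat n) (P *\<^sub>v v) = a \<bullet> b + x \<bullet> y"
      unfolding Pv
      using qf_eval_sum[OF hyperbolic_mat_carrier hyperbolic_mat_carrier, of "a @\<^sub>v b" 1 "x @\<^sub>v y" n]
        qf_eval_hyperbolic[of a 1 b] qf_eval_hyperbolic[of x n y] append_carrier_vec[of a 1 b 1]
      by (simp add: a_def b_def x_def y_def)
    also have "\<dots> = qf_eval (hyperbolic_mat (Suc n)) v"
      by (subst v', subst qf_eval_hyperbolic) (auto simp: a_def b_def x_def y_def, simp add: scalar_prod_def)
    finally show "qf_eval (hyperbolic_mat 1 \<oplus>\<^sub>q hyperbolic_mat n) (P *\<^sub>v v) =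
        qf_eval (hyperbolic_mat (Suc n)) v" .
  next
    show "hyperbolic_mat 1 \<oplus>\<^sub>q hyperbolic_mat n \<in> carrier_mat (2 + (n + n)) (2 + (n + n))"
      using qf_sum_carrier[OF hyperbolic_mat_carrier[of 1] hyperbolic_mat_carrier[of n]] by simp
    show "(hyperbolic_mat (Suc n) :: 'a mat) \<in> carrier_mat (2 + (n + n)) (2 + (n + n))"
      using hyperbolic_mat_carrier[of "Suc n"] by simp
  qed
qed

section \<open>Reflections and cancellation of a hyperbolic plane\<close>

text \<open>
  The reflection \<open>x \<mapsto> x - (b(w, x) / Q(w)) w\<close> in \<open>w = u - v\<close>. With \<open>Q(w)\<close> in the denominator
  instead of \<open>b(w, w) = 2 Q(w)\<close> it makes sense in characteristic 2 as well. From
  \<open>Q(u) = Q(v)\<close> one gets \<open>b(w, u) = Q(w)\<close>, hence \<open>u\<close> is sent to \<open>u - w = v\<close>.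
\<close>

lemma reflection_isometry:
  fixes A :: "'a::field mat"
  assumes A: "A \<in> carrier_mat n n" and u: "u \<in> carrier_vec n" and v: "v \<in> carrier_vec n"
    and eq: "qf_eval A u = qf_eval A v" and nz: "qf_eval A (u - v) \<noteq> 0"
  obtains T where "T \<in> carrier_mat n n" "T *\<^sub>v u = v"
    "\<And>x. x \<in> carrier_vec n \<Longrightarrow> T *\<^sub>v x = 0\<^sub>v n \<Longrightarrow> x = 0\<^sub>v n"
    "\<And>x. x \<in> carrier_vec n \<Longrightarrow> qf_eval A (T *\<^sub>v x) = qf_eval A x"
proof -
  define w where "w = u - v"
  have w: "w \<in> carrier_vec n" using u v unfolding w_def by simp
  have w0: "qf_eval A w \<noteq> 0" using nz unfolding w_def .
  define c where "c = A *\<^sub>v w + A\<^sup>T *\<^sub>v w"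
  have c: "c \<in> carrier_vec n" using A w unfolding c_def by simp
  define r where "r x = - (qf_polar A w x / qf_eval A w)" for x
  define T where "T = mat n n (\<lambda>(i, j). (if i = j then 1 else 0) - w $ i * c $ j / qf_eval A w)"
  have T: "T \<in> carrier_mat n n" unfolding T_def by simp
  have T_eval: "T *\<^sub>v x = x + r x \<cdot>\<^sub>v w" if x: "x \<in> carrier_vec n" for x
  proof (rule eq_vecI)
    fix i assume "i < dim_vec (x + r x \<cdot>\<^sub>v w)"
    then have i: "i < n" using w by simp
    have cx: "(\<Sum>j = 0..<n. c $ j * x $ j) = qf_polar A w x"
      using qf_polar_transpose[OF A w x] x c unfolding c_def by (simp add: scalar_prod_def)
    have "(T *\<^sub>v x) $ i = (\<Sum>j = 0..<n. ((if i = j then 1 else 0) - w $ i * c $ j / qf_eval A w) * x $ j)"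
      using x i unfolding T_def by (auto simp: scalar_prod_def intro!: sum.cong)
    also have "\<dots> = (\<Sum>j = 0..<n. (if i = j then x $ j else 0) - w $ i / qf_eval A w * (c $ j * x $ j))"
      by (rule sum.cong) (auto simp: algebra_simps)
    also have "\<dots> = x $ i - w $ i / qf_eval A w * qf_polar A w x"
      using i unfolding sum_subtractf sum_distrib_left[symmetric] cx by simp
    also have "\<dots> = (x + r x \<cdot>\<^sub>v w) $ i" using i w x unfolding r_def by simp
    finally show "(T *\<^sub>v x) $ i = (x + r x \<cdot>\<^sub>v w) $ i" .
  qed (use T w x in simp)
  have T_isom: "qf_eval A (T *\<^sub>v x) = qf_eval A x" if x: "x \<in> carrier_vec n" for x
  proof -
    have "qf_eval A (T *\<^sub>v x) = qf_eval A x + r x * r x * qf_eval A w + r x * qf_polar A x w"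
      using x w A unfolding T_eval[OF x]
      by (simp add: qf_eval_add[of _ n] qf_eval_smult_vec[of _ n] qf_polar_smult_right[of _ n])
    then show ?thesis using w0 unfolding r_def by (simp add: qf_polar_commute[OF A, of x w])
  qed
  show ?thesis
  proof (rule that[OF T _ _ T_isom])
    have "u = w + v" using u v unfolding w_def by (intro eq_vecI) auto
    then have "qf_eval A v + (qf_polar A w v + qf_eval A w) = qf_eval A v"
      using qf_eval_add[OF A w v] eq by (simp add: ac_simps)
    then have "qf_polar A w v = - qf_eval A w" by (simp add: eq_neg_iff_add_eq_0)
    moreover have "qf_polar A w u = qf_polar A w w + qf_polar A w v"
      unfolding \<open>u = w + v\<close> by (rule qf_polar_add_right[OF A w w v])
    ultimately have "r u = - 1"
      using w0 qf_polar_self[OF A w] unfolding r_def by simp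
    then show "T *\<^sub>v u = v"
      unfolding T_eval[OF u] using u v unfolding w_def by (intro eq_vecI) auto
  next
    fix x assume x: "x \<in> carrier_vec n" and 0: "T *\<^sub>v x = 0\<^sub>v n"
    \<comment> \<open>A reflection is an involution.\<close>
    have "qf_polar A w (T *\<^sub>v x) = - qf_polar A w x"
      unfolding T_eval[OF x] using x w A w0 qf_polar_self[OF A w]
      by (simp add: qf_polar_add_right[of _ n] qf_polar_smult_right[of _ n] r_def)
    moreover have "qf_polar A w (T *\<^sub>v x) = 0" using 0 A w by (simp add: qf_polar_def)
    ultimately have "r x = 0" unfolding r_def by simp
    moreover have "x + 0 \<cdot>\<^sub>v w = x" using x w by (intro eq_vecI) auto
    ultimately show "x = 0\<^sub>v n" using 0 T_eval[OF x] by simp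
  qed
qed

text \<open>
  For isotropic \<open>x\<close> and \<open>y\<close> one has \<open>Q(x - y) = -b(x, y)\<close>. Hence a single reflection does the job
  if \<open>e\<close> and \<open>e'\<close> are not orthogonal, and otherwise two reflections do, through an isotropic vector \<open>h\<close>
  that is orthogonal to neither. The vectors \<open>f\<close> and \<open>f'\<close> say that \<open>e\<close> and \<open>e'\<close> lie outside the
  radical, which is what the construction of \<open>h\<close> needs.
\<close>

lemma isotropic_transitive:
  fixes A :: "'a::field mat"
  assumes A: "A \<in> carrier_mat n n"
    and e: "e \<in> carrier_vec n" "qf_eval A e = 0" and f: "f \<in> carrier_vec n" "qf_polar A e f = 1"
    and e': "e' \<in> carrier_vec n" "qf_eval A e' = 0" and f': "f' \<in> carrier_vec n" "qf_polar A e' f' = 1"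
  obtains T where "T \<in> carrier_mat n n" "T *\<^sub>v e' = e"
    "\<And>x. x \<in> carrier_vec n \<Longrightarrow> T *\<^sub>v x = 0\<^sub>v n \<Longrightarrow> x = 0\<^sub>v n"
    "\<And>x. x \<in> carrier_vec n \<Longrightarrow> qf_eval A (T *\<^sub>v x) = qf_eval A x"
proof -
  have nz: "qf_eval A (x - y) \<noteq> 0"
    if "x \<in> carrier_vec n" "y \<in> carrier_vec n" "qf_eval A x = 0" "qf_eval A y = 0" "qf_polar A x y \<noteq> 0"
    for x y
  proof -
    have "x - y = x + (- 1) \<cdot>\<^sub>v y" using that by (intro eq_vecI) auto
    then show ?thesis using that A
      by (simp add: qf_eval_add[of _ n] qf_eval_smult_vec[of _ n] qf_polar_smult_right[of _ n])
  qed
  \<comment> \<open>One of \<open>f\<close>, \<open>f'\<close> and \<open>f + f'\<close> is orthogonal to neither of the two vectors.\<close>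
  obtain g where g: "g \<in> carrier_vec n" "qf_polar A e g \<noteq> 0" "qf_polar A e' g \<noteq> 0"
  proof (cases "qf_polar A e' f = 0")
    case True
    show ?thesis
    proof (cases "qf_polar A e f' = 0")
      case True
      have "qf_polar A e (f + f') = 1" "qf_polar A e' (f + f') = 1"
        using qf_polar_add_right[OF A e(1) f(1) f'(1)] qf_polar_add_right[OF A e'(1) f(1) f'(1)]
          f f' True \<open>qf_polar A e' f = 0\<close> by simp_all
      then show ?thesis using that[of "f + f'"] f f' by simp
    qed (use that[of f'] f' in simp)
  qed (use that[of f] f in simp)
  \<comment> \<open>Correct \<open>g\<close> by a multiple of \<open>e\<close> to make it isotropic.\<close>
  define h where "h = g + (- (qf_eval A g / qf_polar A e g)) \<cdot>\<^sub>v e"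
  have h: "h \<in> carrier_vec n" using g e unfolding h_def by simp
  have h0: "qf_eval A h = 0"
    using g e A qf_polar_smult_right[OF A g(1) e(1)] qf_polar_commute[OF A, of g e] unfolding h_def
    by (simp add: qf_eval_add[of _ n] qf_eval_smult_vec[of _ n])
  have he: "qf_polar A h e \<noteq> 0"
    using g e A qf_polar_commute[OF A, of g e] qf_polar_self[OF A e(1)] unfolding h_def
    by (simp add: qf_polar_add[of _ n] qf_polar_smult[of _ n])
  show ?thesis
  proof (cases "qf_polar A e' e = 0")
    case False
    show ?thesis
      using reflection_isometry[OF A e'(1) e(1) _ nz[OF e'(1) e(1) e'(2) e(2) False]] e(2) e'(2) that
      by metis
  next
    case True
    have e'h: "qf_polar A e' h \<noteq> 0"
      using g e e' A True unfolding h_def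
      by (simp add: qf_polar_add_right[of _ n] qf_polar_smult_right[of _ n])
    have "qf_eval A e' = qf_eval A h" "qf_eval A h = qf_eval A e" using h0 e e' by simp_all
    obtain T1 where T1: "T1 \<in> carrier_mat n n" "T1 *\<^sub>v e' = h"
      "\<And>x. x \<in> carrier_vec n \<Longrightarrow> T1 *\<^sub>v x = 0\<^sub>v n \<Longrightarrow> x = 0\<^sub>v n"
      "\<And>x. x \<in> carrier_vec n \<Longrightarrow> qf_eval A (T1 *\<^sub>v x) = qf_eval A x"
      using reflection_isometry[OF A e'(1) h \<open>qf_eval A e' = qf_eval A h\<close> nz[OF e'(1) h e'(2) h0 e'h]]
      by blast
    obtain T2 where T2: "T2 \<in> carrier_mat n n" "T2 *\<^sub>v h = e"
      "\<And>x. x \<in> carrier_vec n \<Longrightarrow> T2 *\<^sub>v x = 0\<^sub>v n \<Longrightarrow> x = 0\<^sub>v n"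
      "\<And>x. x \<in> carrier_vec n \<Longrightarrow> qf_eval A (T2 *\<^sub>v x) = qf_eval A x"
      using reflection_isometry[OF A h e(1) \<open>qf_eval A h = qf_eval A e\<close> nz[OF h e(1) h0 e(2) he]]
      by blast
    have prod: "(T2 * T1) *\<^sub>v x = T2 *\<^sub>v (T1 *\<^sub>v x)" if "x \<in> carrier_vec n" for x
      using that T1(1) T2(1) by simp
    show ?thesis
    proof (rule that)
      show "T2 * T1 \<in> carrier_mat n n" using T1(1) T2(1) by simp
      show "(T2 * T1) *\<^sub>v e' = e" using prod[OF e'(1)] T1(2) T2(2) by simp
      fix x :: "'a vec" assume x: "x \<in> carrier_vec n"
      then have T1x: "T1 *\<^sub>v x \<in> carrier_vec n" using T1(1) by simp
      show "x = 0\<^sub>v n" if "(T2 * T1) *\<^sub>v x = 0\<^sub>v n"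
        using T1(3)[OF x T2(3)[OF T1x]] that prod[OF x] by simp
      show "qf_eval A ((T2 * T1) *\<^sub>v x) = qf_eval A x"
        using T2(4)[OF T1x] T1(4)[OF x] prod[OF x] by simp
    qed
  qed
qed

text \<open>
  Let \<open>(e, f)\<close> be the standard basis of the plane. After composition with an isometry of the
  left-hand side, the given isometry \<open>R\<close> fixes \<open>e\<close>. It then maps the orthogonal complement of \<open>e\<close>
  on the right to the one on the left, and the quotients of these complements by the line of \<open>e\<close> are
  the forms \<open>C\<close> and \<open>B\<close>.
\<close>

lemma cancel_hyperbolic_plane:
  fixes B C :: "'a::field mat"
  assumes iso: "hyperbolic_mat 1 \<oplus>\<^sub>q B \<simeq>\<^sub>q hyperbolic_mat 1 \<oplus>\<^sub>q C"
    and B: "B \<in> carrier_mat n n" and C: "C \<in> carrier_mat n n"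
  shows "B \<simeq>\<^sub>q C"
proof -
  \<comment> \<open>\<open>V a b z\<close> stands for the vector \<open>a e + b f + z\<close>.\<close>
  define V where "V a b z = (vec 1 (\<lambda>_. a) @\<^sub>v vec 1 (\<lambda>_. b)) @\<^sub>v z" for a b :: 'a and z
  define K :: "'a mat" where "K = hyperbolic_mat 1"
  have plane: "K \<in> carrier_mat 2 2" unfolding K_def
    using hyperbolic_mat_carrier[of 1] by (simp add: numeral_2_eq_2)
  have plane_vec: "vec 1 (\<lambda>_. a) @\<^sub>v vec 1 (\<lambda>_. b) \<in> carrier_vec 2" for a b :: 'a
    by (intro carrier_vecI) simp
  have V_carrier [simp]: "V a b z \<in> carrier_vec (2 + n)" if "z \<in> carrier_vec n" for a b z
    unfolding V_def by (rule append_carrier_vec[OF plane_vec that])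
  have V_eval: "qf_eval (K \<oplus>\<^sub>q D) (V a b z) = a * b + qf_eval D z"
    if "D \<in> carrier_mat n n" "z \<in> carrier_vec n" for D a b z
    using qf_eval_sum[OF plane that(1) plane_vec that(2)] unfolding V_def
      K_def by (simp add: qf_eval_hyperbolic[of _ 1, simplified]) (simp add: scalar_prod_def)
  have V_add: "V a b z + V a' b' z' = V (a + a') (b + b') (z + z')"
    if "z \<in> carrier_vec n" "z' \<in> carrier_vec n" for a b z a' b' z'
    unfolding V_def using that by (intro eq_vecI) auto
  have V_cases: "\<exists>a b z. v = V a b z \<and> z \<in> carrier_vec n" if v: "v \<in> carrier_vec (2 + n)" for v
  proof -
    obtain p z where p: "v = p @\<^sub>v z" "p \<in> carrier_vec 2" "z \<in> carrier_vec n"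
      using v by (rule carrier_vec_sumE)
    have "p = vec 1 (\<lambda>_. p $ 0) @\<^sub>v vec 1 (\<lambda>_. p $ 1)"
      using p by (intro eq_vecI) (auto simp: numeral_2_eq_2 less_Suc_eq)
    then have "v = V (p $ 0) (p $ 1) z" using p(1) unfolding V_def by (rule subst) 
    then show ?thesis using p(3) by blast
  qed
  have V_polar: "qf_polar (K \<oplus>\<^sub>q D) (V a b z) (V a' b' z') =
      a * b' + a' * b + qf_polar D z z'"
    if "D \<in> carrier_mat n n" "z \<in> carrier_vec n" "z' \<in> carrier_vec n" for D a b z a' b' z'
  proof -
    have "K \<oplus>\<^sub>q D \<in> carrier_mat (2 + n) (2 + n)"
      using plane that(1) by (rule qf_sum_carrier)
    from qf_eval_add[OF this V_carrier V_carrier, of z z' a b a' b']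
    show ?thesis using that
      by (simp add: V_add V_eval qf_eval_add[of _ n] algebra_simps)
  qed
  define H where "H = K \<oplus>\<^sub>q B"
  define H' where "H' = K \<oplus>\<^sub>q C"
  have H: "H \<in> carrier_mat (2 + n) (2 + n)" and H': "H' \<in> carrier_mat (2 + n) (2 + n)"
    unfolding H_def H'_def using B C plane qf_sum_carrier by blast+
  define e where "e = V 1 0 (0\<^sub>v n)"
  define f where "f = V 0 1 (0\<^sub>v n)"
  have e: "e \<in> carrier_vec (2 + n)" and f: "f \<in> carrier_vec (2 + n)"
    unfolding e_def f_def by (rule V_carrier[OF zero_carrier_vec])+
  obtain m P Q where "H \<in> carrier_mat m m"
    and *: "P \<in> carrier_mat m m" "Q \<in> carrier_mat m m"
      "\<And>v. v \<in> carrier_vec m \<Longrightarrow> qf_eval H (P *\<^sub>v v) = qf_eval H' v"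
      "\<And>v. v \<in> carrier_vec m \<Longrightarrow> Q *\<^sub>v (P *\<^sub>v v) = v"
    using iso[folded K_def, folded H_def H'_def] by (rule qf_isometricE) blast
  then have [simp]: "m = 2 + n" using H by auto
  note P = *[unfolded \<open>m = 2 + n\<close>]
  have P_polar: "qf_polar H (P *\<^sub>v u) (P *\<^sub>v v) = qf_polar H' u v"
    if "u \<in> carrier_vec (2 + n)" "v \<in> carrier_vec (2 + n)" for u v
    using qf_polar_isometry[OF H H' P(1,3) that] by simp
  have "qf_eval H e = 0" "qf_polar H e f = 1" "qf_eval H (P *\<^sub>v e) = 0"
    "qf_polar H (P *\<^sub>v e) (P *\<^sub>v f) = 1" 
    using P(3)[OF e] P_polar[OF e f] B C unfolding H_def H'_def e_def f_def
    by (simp_all add: V_eval V_polar qf_eval_zero[of _ n] qf_polar_def[of _ "0\<^sub>v n"])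
  moreover have "P *\<^sub>v e \<in> carrier_vec (2 + n)" "P *\<^sub>v f \<in> carrier_vec (2 + n)" using P e f by simp_all
  ultimately obtain T where T: "T \<in> carrier_mat (2 + n) (2 + n)" "T *\<^sub>v (P *\<^sub>v e) = e"
    "\<And>x. x \<in> carrier_vec (2 + n) \<Longrightarrow> T *\<^sub>v x = 0\<^sub>v (2 + n) \<Longrightarrow> x = 0\<^sub>v (2 + n)"
    "\<And>x. x \<in> carrier_vec (2 + n) \<Longrightarrow> qf_eval H (T *\<^sub>v x) = qf_eval H x"
    using isotropic_transitive[OF H e, of f "P *\<^sub>v e" "P *\<^sub>v f"] f by blast
  define R where "R = T * P"
  have R: "R \<in> carrier_mat (2 + n) (2 + n)" using T P unfolding R_def by simp
  have R_apply: "R *\<^sub>v x = T *\<^sub>v (P *\<^sub>v x)" if "x \<in> carrier_vec (2 + n)" for x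
    using that T(1) P(1) unfolding R_def by (rule assoc_mult_mat_vec[rotated 2])
  have Re: "R *\<^sub>v e = e" using R_apply[OF e] T(2) by simp
  have R_eval: "qf_eval H (R *\<^sub>v x) = qf_eval H' x" if "x \<in> carrier_vec (2 + n)" for x
    using R_apply[OF that] T(4) P(1,3) that by simp
  have R_inj: "x = 0\<^sub>v (2 + n)" if x: "x \<in> carrier_vec (2 + n)" "R *\<^sub>v x = 0\<^sub>v (2 + n)" for x
  proof -
    have "P *\<^sub>v x = 0\<^sub>v (2 + n)" using T(3)[of "P *\<^sub>v x"] R_apply[OF x(1)] x P(1) by simp
    then show ?thesis using P(4)[OF x(1)] P(2) by simp
  qed
  obtain R1 R2 R3 G where "split_block R 2 2 = (R1, R2, R3, G)" using prod_cases4 by blast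
  from split_block[OF this, of n n] R
  have blocks: "R1 \<in> carrier_mat 2 2" "R2 \<in> carrier_mat 2 n" "R3 \<in> carrier_mat n 2"
    "G \<in> carrier_mat n n" "R = four_block_mat R1 R2 R3 G"
    by auto
  have V0: "V 0 0 w = 0\<^sub>v 2 @\<^sub>v w" for w
    unfolding V_def by (intro eq_vecI) (auto simp: numeral_2_eq_2)
  \<comment> \<open>Since \<open>e\<close> is fixed, the image of \<open>w\<close> stays orthogonal to \<open>e\<close>.\<close>
  have R_V: "\<exists>a. R *\<^sub>v V 0 0 w = V a 0 (G *\<^sub>v w)" if w: "w \<in> carrier_vec n" for w
  proof -
    obtain a b z where abz: "R *\<^sub>v V 0 0 w = V a b z" "z \<in> carrier_vec n"
      using V_cases[OF mult_mat_vec_carrier[OF R V_carrier[OF w, of 0 0]]] by blast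
    have "b = qf_polar H (V a b z) e"
      using B abz unfolding H_def e_def by (simp add: V_polar qf_polar_def[of _ _ "0\<^sub>v n"])
    also have "\<dots> = qf_polar H' (V 0 0 w) e"
      using qf_polar_isometry[OF H H' R R_eval V_carrier[OF w] e, of 0 0] abz Re by simp
    also have "\<dots> = 0"
      using C w unfolding H'_def e_def by (simp add: V_polar qf_polar_def[of _ _ "0\<^sub>v n"])
    finally have "b = 0" .
    have "R *\<^sub>v V 0 0 w = (R1 *\<^sub>v 0\<^sub>v 2 + R2 *\<^sub>v w) @\<^sub>v (R3 *\<^sub>v 0\<^sub>v 2 + G *\<^sub>v w)"
      unfolding V0 blocks(5) by (rule four_block_mat_mult_vec[OF blocks(1-4)]) (use w in auto)
    also have "\<dots> = (R2 *\<^sub>v w) @\<^sub>v (G *\<^sub>v w)" using blocks w by simp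
    finally have "(vec 1 (\<lambda>_. a) @\<^sub>v vec 1 (\<lambda>_. b)) @\<^sub>v z = (R2 *\<^sub>v w) @\<^sub>v (G *\<^sub>v w)"
      using abz(1) unfolding V_def by simp
    then have "z = G *\<^sub>v w"
      using append_vec_eq[OF plane_vec mult_mat_vec_carrier[OF blocks(2) w]] by blast
    then show ?thesis using abz \<open>b = 0\<close> by auto
  qed
  show ?thesis
  proof (rule qf_isometricI[OF B C blocks(4)])
    fix w :: "'a vec" assume w: "w \<in> carrier_vec n"
    then have Gw: "G *\<^sub>v w \<in> carrier_vec n" using blocks(4) by simp
    obtain a where a: "R *\<^sub>v V 0 0 w = V a 0 (G *\<^sub>v w)" using R_V[OF w] by blast
    show "qf_eval B (G *\<^sub>v w) = qf_eval C w"
      using R_eval[OF V_carrier[OF w], of 0 0] a V_eval[OF B Gw, of a 0] V_eval[OF C w, of 0 0]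
      unfolding H_def H'_def by simp
    show "w = 0\<^sub>v n" if 0: "G *\<^sub>v w = 0\<^sub>v n"
    proof -
      have "V a 0 (0\<^sub>v n) = a \<cdot>\<^sub>v e" unfolding e_def V_def by (intro eq_vecI) auto
      then have "R *\<^sub>v (V 0 0 w + (- a) \<cdot>\<^sub>v e) = a \<cdot>\<^sub>v e + (- a) \<cdot>\<^sub>v e"
        using a 0 R w e Re mult_mat_vec[OF R e, of "- a"]
          V_carrier[OF w, of 0 0] mult_add_distrib_mat_vec[OF R, of "V 0 0 w" "(- a) \<cdot>\<^sub>v e"]
        by simp
      then have "R *\<^sub>v (V 0 0 w + (- a) \<cdot>\<^sub>v e) = 0\<^sub>v (2 + n)"
        using e by (auto intro!: eq_vecI)
      then have "V 0 0 w + (- a) \<cdot>\<^sub>v e = 0\<^sub>v (2 + n)"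
        using R_inj[of "V 0 0 w + (- a) \<cdot>\<^sub>v e"] V_carrier[OF w, of 0 0] e
        by (meson add_carrier_vec smult_carrier_vec)
      moreover have "(- a) \<cdot>\<^sub>v e = V (- a) 0 (0\<^sub>v n)" unfolding e_def V_def by (intro eq_vecI) auto
      ultimately have "(vec 1 (\<lambda>_. - a) @\<^sub>v vec 1 (\<lambda>_. 0)) @\<^sub>v w = 0\<^sub>v (2 + n)"
        using V_add[OF w, of "0\<^sub>v n" 0 0 "- a" 0] w unfolding V_def by simp
      then show ?thesis using append_eq_zero_iff[OF plane_vec] by blast
    qed
  qed
qed

section \<open>Values, isotropy and a dimension count\<close>

text \<open>
  Fewer equations than unknowns: padding with zero rows gives a singular square matrix.
\<close>

lemma kernel_vector:
  fixes M :: "'a::field mat"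
  assumes M: "M \<in> carrier_mat m n" and "m < n"
  obtains v where "v \<in> carrier_vec n" "v \<noteq> 0\<^sub>v n" "M *\<^sub>v v = 0\<^sub>v m"
proof -
  define N where "N = mat n n (\<lambda>(i, j). if i < m then M $$ (i, j) else 0)"
  have N: "N \<in> carrier_mat n n" unfolding N_def by simp
  have "N\<^sup>T *\<^sub>v unit_vec n m = 0\<^sub>v n"
    using \<open>m < n\<close> by (intro eq_vecI) (auto simp: N_def scalar_prod_def intro!: sum.neutral)
  moreover have "unit_vec n m \<noteq> (0\<^sub>v n :: 'a vec)"
    using \<open>m < n\<close> by (metis index_unit_vec(1) index_zero_vec(1) zero_neq_one)
  ultimately have "det N\<^sup>T = 0"
    using det_0_iff_vec_prod_zero_field[OF transpose_carrier_mat[THEN iffD2, OF N]]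
      unit_vec_carrier[of n m] by blast
  then obtain v where v: "v \<in> carrier_vec n" "v \<noteq> 0\<^sub>v n" "N *\<^sub>v v = 0\<^sub>v n"
    using det_0_iff_vec_prod_zero_field[OF N] det_transpose[OF N] by auto
  have "M *\<^sub>v v = 0\<^sub>v m"
  proof (rule eq_vecI)
    fix i assume "i < dim_vec (0\<^sub>v m :: 'a vec)"
    then have i: "i < m" by simp
    have "row M i = row N i" using i \<open>m < n\<close> M N by (intro eq_vecI) (auto simp: N_def)
    then show "(M *\<^sub>v v) $ i = 0\<^sub>v m $ i"
      using v(3)[THEN arg_cong, of "\<lambda>w. w $ i"] i \<open>m < n\<close> M N by simp
  qed (use M in simp)
  with v that show ?thesis by blast
qed

definition qf_anisotropic :: "'a::field mat \<Rightarrow> bool" where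
  "qf_anisotropic A \<longleftrightarrow>
     (\<forall>v \<in> carrier_vec (dim_row A). qf_eval A v = 0 \<longrightarrow> v = 0\<^sub>v (dim_row A))"

definition qf_values :: "'a::field mat \<Rightarrow> 'a set" where
  "qf_values A = qf_eval A ` carrier_vec (dim_row A)"

text \<open>
  Read both decompositions in the same space: the subspaces carrying \<open>B\<close> and \<open>B'\<close> have codimensions
  \<open>n\<close> and \<open>n'\<close>, so they share a nonzero vector if \<open>n + n'\<close> is less than the dimension. Its value is
  nonzero by anisotropy.
\<close>

lemma common_value:
  fixes A B A' B' :: "'a::field mat"
  assumes iso: "A \<oplus>\<^sub>q B \<simeq>\<^sub>q A' \<oplus>\<^sub>q B'"
    and A: "A \<in> carrier_mat n n" and B: "B \<in> carrier_mat m m"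
    and A': "A' \<in> carrier_mat n' n'" and B': "B' \<in> carrier_mat m' m'"
    and dims: "n + n' < n + m" and aniso: "qf_anisotropic (A \<oplus>\<^sub>q B)"
  shows "\<exists>c. c \<noteq> 0 \<and> c \<in> qf_values B \<and> c \<in> qf_values B'"
proof -
  let ?N = "n + m"
  have S: "A \<oplus>\<^sub>q B \<in> carrier_mat ?N ?N" and S': "A' \<oplus>\<^sub>q B' \<in> carrier_mat (n' + m') (n' + m')"
    using A B A' B' by simp_all
  have N': "n' + m' = ?N" using qf_isometric_carrierD[OF iso S] S' by (metis carrier_matD(1))
  obtain k P Q where k: "A \<oplus>\<^sub>q B \<in> carrier_mat k k"
    and *: "P \<in> carrier_mat k k" "Q \<in> carrier_mat k k"
      "\<And>v. v \<in> carrier_vec k \<Longrightarrow> qf_eval (A \<oplus>\<^sub>q B) (P *\<^sub>v v) = qf_eval (A' \<oplus>\<^sub>q B') v"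
      "\<And>v. v \<in> carrier_vec k \<Longrightarrow> Q *\<^sub>v (P *\<^sub>v v) = v"
    using iso by (rule qf_isometricE) blast
  have "k = ?N" using k S by auto
  note P = *[unfolded this]
  \<comment> \<open>A vector that lies in the second summand for both decompositions solves \<open>n + n'\<close> equations.\<close>
  define M where "M = mat (n + n') ?N (\<lambda>(i, j). if i < n then P $$ (i, j) else if j = i - n then 1 else 0)"
  have M: "M \<in> carrier_mat (n + n') ?N" unfolding M_def by simp
  obtain v where v: "v \<in> carrier_vec ?N" "v \<noteq> 0\<^sub>v ?N" "M *\<^sub>v v = 0\<^sub>v (n + n')"
    using kernel_vector[OF M dims] by blast
  have 1: "(P *\<^sub>v v) $ i = 0" if "i < n" for i
  proof -
    have "row M i = row P i" using that P(1) unfolding M_def by (intro eq_vecI) auto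
    then show ?thesis using v(3)[THEN arg_cong, of "\<lambda>w. w $ i"] that P(1) M by simp
  qed
  have 2: "v $ i = 0" if "i < n'" for i
  proof -
    have "row M (n + i) = unit_vec ?N i" using that dims unfolding M_def by (intro eq_vecI) auto
    moreover have "(M *\<^sub>v v) $ (n + i) = 0" using v(3) that by simp
    ultimately show ?thesis using that M dims v(1) by simp
  qed
  obtain x y where xy: "P *\<^sub>v v = x @\<^sub>v y" "x \<in> carrier_vec n" "y \<in> carrier_vec m"
    using carrier_vec_sumE[of "P *\<^sub>v v" n m] P(1) v(1) by auto
  have "x = 0\<^sub>v n" using 1 xy(2,3) unfolding xy(1) by (intro eq_vecI) auto
  obtain x' y' where xy': "v = x' @\<^sub>v y'" "x' \<in> carrier_vec n'" "y' \<in> carrier_vec m'"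
    using carrier_vec_sumE[of v n' m'] v(1) N' by auto
  have "x' = 0\<^sub>v n'" using 2 xy'(2,3) unfolding xy'(1) by (intro eq_vecI) auto
  have "P *\<^sub>v v \<noteq> 0\<^sub>v ?N" using P(4)[OF v(1)] P(2) v(2) by auto
  then have nz: "qf_eval (A \<oplus>\<^sub>q B) (P *\<^sub>v v) \<noteq> 0"
    using aniso S P(1) v(1) unfolding qf_anisotropic_def by auto
  have "qf_eval (A \<oplus>\<^sub>q B) (P *\<^sub>v v) = qf_eval B y"
    using qf_eval_sum[OF A B xy(2,3)] xy(1) \<open>x = 0\<^sub>v n\<close> qf_eval_zero[OF A] by simp
  moreover have "qf_eval (A \<oplus>\<^sub>q B) (P *\<^sub>v v) = qf_eval B' y'"
    using qf_eval_sum[OF A' B' xy'(2,3)] xy'(1) \<open>x' = 0\<^sub>v n'\<close> qf_eval_zero[OF A'] P(3)[OF v(1)] by simp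
  ultimately show ?thesis
    using nz imageI[OF xy(3), of "qf_eval B"] imageI[OF xy'(3), of "qf_eval B'"] B B'
    unfolding qf_values_def by auto
qed

text \<open>
  If \<open>v\<close> is isotropic and \<open>b(v, g) \<noteq> 0\<close>, then \<open>Q\<close> is an affine function on the line \<open>g + t v\<close>
  with nonzero slope, and so it takes every value there.
\<close>

lemma isotropic_universal:
  fixes A :: "'a::field mat"
  assumes A: "A \<in> carrier_mat n n" and ns: "qf_nonsingular A" and iso: "\<not> qf_anisotropic A"
  shows "qf_values A = UNIV"
proof -
  obtain v where v: "v \<in> carrier_vec n" "qf_eval A v = 0" "v \<noteq> 0\<^sub>v n"
    using iso A unfolding qf_anisotropic_def by auto
  obtain g where g: "g \<in> carrier_vec n" "qf_polar A v g \<noteq> 0"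
    using qf_nonsingularD[OF ns A v(1)] v(3) by blast
  have "\<exists>w \<in> carrier_vec n. qf_eval A w = c" for c
  proof
    define t where "t = (c - qf_eval A g) / qf_polar A v g"
    show "g + t \<cdot>\<^sub>v v \<in> carrier_vec n" using g v by simp
    have "qf_eval A (g + t \<cdot>\<^sub>v v) = qf_eval A g + t * qf_polar A v g"
      using A g v qf_polar_smult_right[OF A g(1) v(1)] qf_polar_commute[OF A, of g v]
      by (simp add: qf_eval_add[of _ n] qf_eval_smult_vec[of _ n])
    then show "qf_eval A (g + t \<cdot>\<^sub>v v) = c" using g unfolding t_def by simp
  qed
  then show ?thesis using A unfolding qf_values_def by (auto simp: image_iff) metis
qed

lemma qf_values_sum:
  fixes A B :: "'a::field mat"
  assumes A: "A \<in> carrier_mat n n" and B: "B \<in> carrier_mat m m"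
  shows "qf_values (A \<oplus>\<^sub>q B) = {x + y | x y. x \<in> qf_values A \<and> y \<in> qf_values B}"
proof -
  have "dim_row (A \<oplus>\<^sub>q B) = n + m" using qf_sum_carrier[OF A B] by auto
  moreover have "(carrier_vec (n + m) :: 'a vec set) = {x @\<^sub>v y | x y. x \<in> carrier_vec n \<and> y \<in> carrier_vec m}"
  proof (intro equalityI subsetI)
    fix v :: "'a vec" assume "v \<in> carrier_vec (n + m)"
    then obtain x y where "v = x @\<^sub>v y" "x \<in> carrier_vec n" "y \<in> carrier_vec m"
      by (rule carrier_vec_sumE)
    then show "v \<in> {x @\<^sub>v y | x y. x \<in> carrier_vec n \<and> y \<in> carrier_vec m}" by blast
  qed auto
  ultimately have "qf_values (A \<oplus>\<^sub>q B) =
      {qf_eval (A \<oplus>\<^sub>q B) (x @\<^sub>v y) | x y. x \<in> carrier_vec n \<and> y \<in> carrier_vec m}"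
    unfolding qf_values_def by auto
  also have "\<dots> = {qf_eval A x + qf_eval B y | x y. x \<in> carrier_vec n \<and> y \<in> carrier_vec m}"
    using qf_eval_sum[OF A B] by (intro Collect_cong ex_cong1) auto
  finally show ?thesis using A B unfolding qf_values_def by auto
qed

lemma qf_values_smult:
  assumes A: "A \<in> carrier_mat n n"
  shows "qf_values (c \<cdot>\<^sub>m A) = (*) c ` qf_values A"
  using A by (auto simp: qf_values_def qf_eval_smult[of _ n] image_iff)

lemma qf_values_cong:
  fixes A B :: "'a::field mat"
  assumes "A \<simeq>\<^sub>q B" shows "qf_values A = qf_values B"
proof -
  have "qf_values B \<subseteq> qf_values A" if "A \<simeq>\<^sub>q B" for A B :: "'a mat"
    using that 
  proof (rule qf_isometricE)
    fix n P R
    assume *: "A \<in> carrier_mat n n" "B \<in> carrier_mat n n" "P \<in> carrier_mat n n"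
      "\<And>v. v \<in> carrier_vec n \<Longrightarrow> qf_eval A (P *\<^sub>v v) = qf_eval B v"
    have "qf_eval B v \<in> qf_eval A ` carrier_vec n" if "v \<in> carrier_vec n" for v
      using *(4)[OF that, symmetric] mult_mat_vec_carrier[OF *(3) that] by (rule image_eqI)
    then show ?thesis using *(1,2) unfolding qf_values_def by auto
  qed
  then show ?thesis using assms qf_isometric_sym by blast
qed

lemma qf_anisotropic_cong:
  fixes A B :: "'a::field mat"
  assumes "A \<simeq>\<^sub>q B" "qf_anisotropic A" shows "qf_anisotropic B"
  using assms(1)
proof (rule qf_isometricE)
  fix n P R
  assume *: "A \<in> carrier_mat n n" "B \<in> carrier_mat n n"
    "P \<in> carrier_mat n n" "R \<in> carrier_mat n n"
    "\<And>v. v \<in> carrier_vec n \<Longrightarrow> qf_eval A (P *\<^sub>v v) = qf_eval B v"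
    "\<And>v. v \<in> carrier_vec n \<Longrightarrow> R *\<^sub>v (P *\<^sub>v v) = v"
  have "v = 0\<^sub>v n" if v: "v \<in> carrier_vec n" "qf_eval B v = 0" for v
  proof -
    have "P *\<^sub>v v = 0\<^sub>v n"
      using assms(2) *(1,3) *(5)[OF v(1)] v unfolding qf_anisotropic_def by auto
    then show ?thesis using *(6)[OF v(1)] *(4) by simp
  qed
  then show ?thesis using *(2) unfolding qf_anisotropic_def by auto
qed

section \<open>The monoid of isometry classes\<close>

lemma qf_isometric_self_carrier: "A \<simeq>\<^sub>q A \<Longrightarrow> A \<in> carrier_mat (dim_row A) (dim_row A)"
  unfolding qf_isometric_def by auto

text \<open>
  On isometry classes orthogonal sum is an associative and commutative addition, so that the
  rearrangements of summands below become rewriting steps. The equivalence is partial because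
  only square matrices represent forms.
\<close>

quotient_type (overloaded) 'a qform = "'a::field mat" / partial: qf_isometric
proof (rule part_equivpI)
  show "\<exists>A :: 'a mat. A \<simeq>\<^sub>q A" using qf_isometric_refl[of "0\<^sub>m 0 0 :: 'a mat" 0] by auto
  show "symp (qf_isometric :: 'a mat \<Rightarrow> 'a mat \<Rightarrow> bool)" by (rule sympI) (rule qf_isometric_sym)
  show "transp (qf_isometric :: 'a mat \<Rightarrow> 'a mat \<Rightarrow> bool)" by (rule transpI) (rule qf_isometric_trans)
qed

instantiation qform :: (field) comm_monoid_add
begin

lift_definition zero_qform :: "'a qform" is "0\<^sub>m 0 0" by (rule qf_isometric_refl[of _ 0]) simp

lift_definition plus_qform :: "'a qform \<Rightarrow> 'a qform \<Rightarrow> 'a qform" is "\<lambda>A B. A \<oplus>\<^sub>q B"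
  by (rule qf_sum_cong)

instance
proof
  fix a b c :: "'a qform"
  show "a + b + c = a + (b + c)"
    by transfer (subst qf_sum_assoc, intro qf_sum_cong)
  show "a + b = b + a"
    by transfer (rule qf_sum_commute[OF qf_isometric_self_carrier qf_isometric_self_carrier])
  show "0 + a = a"
    by transfer (simp add: qf_sum_zero_left)
qed

end

lift_definition qscale :: "'a::field \<Rightarrow> 'a qform \<Rightarrow> 'a qform"  (infixr "\<cdot>\<^sub>q" 75) is "\<lambda>c A. c \<cdot>\<^sub>m A"
  by (rule qf_smult_cong)

lift_definition qdim :: "'a::field qform \<Rightarrow> nat" is dim_row
  unfolding qf_isometric_def by auto

lift_definition qvals :: "'a::field qform \<Rightarrow> 'a set" is qf_values
  by (rule qf_values_cong)

lift_definition nonsingular :: "'a::field qform \<Rightarrow> bool" is qf_nonsingular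
  using qf_nonsingular_cong qf_isometric_sym by blast

lift_definition anisotropic :: "'a::field qform \<Rightarrow> bool" is qf_anisotropic
  using qf_anisotropic_cong qf_isometric_sym by blast

lemma qdim_add [simp]: "qdim (p + q) = qdim p + qdim q"
  by transfer (simp add: qf_sum_def)

lemma qdim_scale [simp]: "qdim (c \<cdot>\<^sub>q q) = qdim q"
  by transfer simp

lemma qscale_add: "c \<cdot>\<^sub>q (p + q) = c \<cdot>\<^sub>q p + c \<cdot>\<^sub>q q"
proof transfer
  fix c :: 'a and A B :: "'a mat"
  assume "A \<simeq>\<^sub>q A" "B \<simeq>\<^sub>q B"
  then show "c \<cdot>\<^sub>m (A \<oplus>\<^sub>q B) \<simeq>\<^sub>q c \<cdot>\<^sub>m A \<oplus>\<^sub>q c \<cdot>\<^sub>m B"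
    using qf_smult_sum[OF qf_isometric_self_carrier qf_isometric_self_carrier, of A B c]
      qf_smult_cong[OF qf_sum_cong, of A A B B c] by simp
qed

lemma qscale_scale: "a \<cdot>\<^sub>q b \<cdot>\<^sub>q q = (a * b) \<cdot>\<^sub>q q"
proof transfer
  fix a b :: 'a and A :: "'a mat"
  have "a \<cdot>\<^sub>m (b \<cdot>\<^sub>m A) = (a * b) \<cdot>\<^sub>m A" by (intro eq_matI) auto
  then show "a \<cdot>\<^sub>m (b \<cdot>\<^sub>m A) \<simeq>\<^sub>q (a * b) \<cdot>\<^sub>m A" if "A \<simeq>\<^sub>q A"
    using qf_smult_cong[OF that, of "a * b"] by simp
qed

lemma qscale_one [simp]: "1 \<cdot>\<^sub>q q = q"
proof transfer
  fix A :: "'a mat"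
  have "1 \<cdot>\<^sub>m A = A" by (intro eq_matI) auto
  then show "A \<simeq>\<^sub>q A \<Longrightarrow> 1 \<cdot>\<^sub>m A \<simeq>\<^sub>q A" by simp
qed

lemma qscale_square: "c \<noteq> 0 \<Longrightarrow> (c * c) \<cdot>\<^sub>q q = q"
  by transfer (rule qf_smult_square[OF qf_isometric_self_carrier])

lemma scaled_pair:
  "u + v \<noteq> 0 \<Longrightarrow> u \<cdot>\<^sub>q q + v \<cdot>\<^sub>q q = (u + v) \<cdot>\<^sub>q q + ((u + v) * (u * v)) \<cdot>\<^sub>q q"
  by transfer (rule qf_scaled_pair[OF qf_isometric_self_carrier])

lemma nonsingular_add: "nonsingular p \<Longrightarrow> nonsingular q \<Longrightarrow> nonsingular (p + q)"
  by transfer (rule qf_nonsingular_sum[OF qf_isometric_self_carrier _ qf_isometric_self_carrier])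

lemma nonsingular_scale: "nonsingular q \<Longrightarrow> c \<noteq> 0 \<Longrightarrow> nonsingular (c \<cdot>\<^sub>q q)"
  by transfer (rule qf_nonsingular_smult[OF qf_isometric_self_carrier])

lemma qvals_add: "qvals (p + q) = {x + y | x y. x \<in> qvals p \<and> y \<in> qvals q}"
  by transfer (rule qf_values_sum[OF qf_isometric_self_carrier qf_isometric_self_carrier])

lemma qvals_scale: "qvals (c \<cdot>\<^sub>q q) = (*) c ` qvals q"
  by transfer (rule qf_values_smult[OF qf_isometric_self_carrier])

lemma zero_in_qvals: "0 \<in> qvals q"
proof transfer
  fix A :: "'a mat" assume "A \<simeq>\<^sub>q A"
  then have "qf_eval A (0\<^sub>v (dim_row A)) = 0" by (rule qf_eval_zero[OF qf_isometric_self_carrier])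
  then show "0 \<in> qf_values A" unfolding qf_values_def by (auto intro: image_eqI[OF sym])
qed

lemma universal_if_isotropic: "nonsingular q \<Longrightarrow> \<not> anisotropic q \<Longrightarrow> qvals q = UNIV"
  by transfer (rule isotropic_universal[OF qf_isometric_self_carrier])

lemma common_complement_value:
  assumes "p + q = p' + q'" "qdim p + qdim p' < qdim (p + q)" "anisotropic (p + q)"
  shows "\<exists>c. c \<noteq> 0 \<and> c \<in> qvals q \<and> c \<in> qvals q'"
  using assms
proof transfer
  fix A B A' B' :: "'a mat"
  assume "A \<simeq>\<^sub>q A" "B \<simeq>\<^sub>q B" "A' \<simeq>\<^sub>q A'" "B' \<simeq>\<^sub>q B'" and *: "A \<oplus>\<^sub>q B \<simeq>\<^sub>q A' \<oplus>\<^sub>q B'"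
    "dim_row A + dim_row A' < dim_row (A \<oplus>\<^sub>q B)" "qf_anisotropic (A \<oplus>\<^sub>q B)"
  note carriers = this(1-4)[THEN qf_isometric_self_carrier]
  have "dim_row A + dim_row A' < dim_row A + dim_row B" using *(2) by (simp add: qf_sum_def)
  then show "\<exists>c. c \<noteq> 0 \<and> c \<in> qf_values B \<and> c \<in> qf_values B'"
    by (rule common_value[OF *(1) carriers _ *(3)])
qed

lift_definition hyperbolic :: "nat \<Rightarrow> 'a::field qform" is hyperbolic_mat
  by (rule qf_isometric_refl[OF hyperbolic_mat_carrier])

lemma hyperbolic_Suc: "hyperbolic 1 + hyperbolic n = hyperbolic (Suc n)"
  by transfer (rule hyperbolic_mat_Suc)

lemma hyperbolic_0: "hyperbolic 0 = 0"
  by transfer (auto intro!: qf_isometric_eqvI[of _ 0] simp: hyperbolic_mat_def qf_eval_def scalar_prod_def)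

lemma add_negative: "nonsingular q \<Longrightarrow> q + (-1) \<cdot>\<^sub>q q = hyperbolic (qdim q)"
  by transfer (rule qf_sum_negative_hyperbolic[OF qf_isometric_self_carrier])

lemma cancel_plane:
  assumes "hyperbolic 1 + p = hyperbolic 1 + q"
  shows "p = q"
proof -
  have "qdim p = qdim q" using arg_cong[OF assms, of qdim] by simp
  with assms show ?thesis
  proof transfer
    fix B C :: "'a mat"
    assume "B \<simeq>\<^sub>q B" "C \<simeq>\<^sub>q C" and *: "hyperbolic_mat 1 \<oplus>\<^sub>q B \<simeq>\<^sub>q hyperbolic_mat 1 \<oplus>\<^sub>q C"
      "dim_row B = dim_row C"
    note carriers = this(1,2)[THEN qf_isometric_self_carrier]
    show "B \<simeq>\<^sub>q C" by (rule cancel_hyperbolic_plane[OF *(1) carriers(1)[unfolded *(2)] carriers(2)])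
  qed
qed

lemma cancel_hyperbolic: "hyperbolic n + p = hyperbolic n + q \<Longrightarrow> p = q"
proof (induction n)
  case 0
  then show ?case by (simp add: hyperbolic_0)
next
  case (Suc n)
  then show ?case
    using cancel_plane[of "hyperbolic n + p" "hyperbolic n + q"]
    unfolding hyperbolic_Suc[of n, symmetric] add.assoc by blast
qed

text \<open>
  Adding \<open>-q\<close> on both sides turns \<open>q\<close> into a sum of hyperbolic planes, which cancel one at a time.
\<close>

lemma witt_cancellation:
  assumes "nonsingular q" "q + p = q + p'"
  shows "p = p'"
proof (rule cancel_hyperbolic[of "qdim q"])
  show "hyperbolic (qdim q) + p = hyperbolic (qdim q) + p'"
    unfolding add_negative[OF assms(1), symmetric]
    using arg_cong[OF assms(2), of "(+) ((- 1) \<cdot>\<^sub>q q)"] by (simp add: ac_simps)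
qed

section \<open>Pfister multiples\<close>

text \<open>
  The form \<open>\<langle>\<langle>a\<^sub>1, \<dots>, a\<^sub>r\<rangle>\<rangle> \<otimes> q\<close>.
\<close>

fun pfister :: "'a::field list \<Rightarrow> 'a qform \<Rightarrow> 'a qform" where
  "pfister [] q = q"
| "pfister (a # as) q = pfister as q + (- a) \<cdot>\<^sub>q pfister as q"

lemma pfister_append: "pfister (as @ bs) q = pfister as (pfister bs q)"
  by (induction as) simp_all

lemma pfister_add: "pfister as (p + q) = pfister as p + pfister as q"
  by (induction as) (simp_all add: qscale_add ac_simps)

lemma pfister_scale: "pfister as (c \<cdot>\<^sub>q q) = c \<cdot>\<^sub>q pfister as q"
  by (induction as) (simp_all add: qscale_add qscale_scale ac_simps)

lemma pfister_absorb_slot: "pfister as (pfister [a] q) = pfister (a # as) q"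
  by (simp add: pfister_add pfister_scale)

lemma pfister_commute: "pfister as (pfister bs q) = pfister bs (pfister as q)"
  by (induction as) (simp_all add: pfister_add pfister_scale)

lemma qdim_pfister: "qdim (pfister as q) = 2 ^ length as * qdim q"
  by (induction as) simp_all

text \<open>
  Roundness proper is the last conjunct: every nonzero value of \<open>q\<close> is a similarity factor of \<open>q\<close>.
  The three properties together pass from \<open>q\<close> to \<open>\<langle>\<langle>a\<rangle>\<rangle> \<otimes> q\<close> for \<open>a \<noteq> 0\<close>. Apart from the dimension
  they are all that the linkage argument uses about quadratic Pfister forms.
\<close>

definition round_form :: "'a::field qform \<Rightarrow> bool" where
  "round_form q \<longleftrightarrow> nonsingular q \<and> 1 \<in> qvals q \<and> (\<forall>c \<in> qvals q. c \<noteq> 0 \<longrightarrow> c \<cdot>\<^sub>q q = q)"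

lemma round_formD:
  assumes "round_form q"
  shows "nonsingular q" "1 \<in> qvals q" "c \<in> qvals q \<Longrightarrow> c \<noteq> 0 \<Longrightarrow> c \<cdot>\<^sub>q q = q"
  using assms unfolding round_form_def by auto

lemma qscale_absorb:
  assumes "round_form q" "c \<in> qvals q" "c \<noteq> 0"
  shows "(d * c) \<cdot>\<^sub>q q = d \<cdot>\<^sub>q q"
  using round_formD(3)[OF assms] by (metis qscale_scale)

text \<open>
  A value of \<open>\<langle>\<langle>a\<rangle>\<rangle> \<otimes> q\<close> has the form \<open>c = x - a y\<close> with values \<open>x\<close>, \<open>y\<close> of \<open>q\<close>. If both are
  nonzero, then roundness of \<open>q\<close> gives
  \<open>q - a q = x q - a y q = c (q - a x y q) = c (q - a q)\<close>, where the second step is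
  \<open>scaled_pair\<close>. If one of them vanishes, then \<open>c\<close> is a similarity factor of \<open>q\<close>, or \<open>-a\<close> times such a
  factor, which exchanges the two summands.
\<close>

lemma round_double:
  assumes q: "round_form q" and a: "a \<noteq> 0"
  shows "round_form (q + (- a) \<cdot>\<^sub>q q)"
  unfolding round_form_def
proof (intro conjI ballI impI)
  show "nonsingular (q + (- a) \<cdot>\<^sub>q q)"
    using round_formD(1)[OF q] a by (simp add: nonsingular_add nonsingular_scale)
  show "1 \<in> qvals (q + (- a) \<cdot>\<^sub>q q)"
    using round_formD(2)[OF q] zero_in_qvals[of "(- a) \<cdot>\<^sub>q q"] unfolding qvals_add by force
  fix c assume "c \<in> qvals (q + (- a) \<cdot>\<^sub>q q)" and c0: "c \<noteq> 0"
  then obtain x y where xy: "x \<in> qvals q" "y \<in> qvals q" and c: "c = x + (- a) * y"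
    unfolding qvals_add qvals_scale by auto
  have x: "(d * x) \<cdot>\<^sub>q q = d \<cdot>\<^sub>q q" if "x \<noteq> 0" for d using qscale_absorb[OF q xy(1) that] .
  have y: "(d * y) \<cdot>\<^sub>q q = d \<cdot>\<^sub>q q" if "y \<noteq> 0" for d using qscale_absorb[OF q xy(2) that] .
  consider "y = 0" "x \<noteq> 0" | "x = 0" "y \<noteq> 0" | "x \<noteq> 0" "y \<noteq> 0" using c c0 by force
  then show "c \<cdot>\<^sub>q (q + (- a) \<cdot>\<^sub>q q) = q + (- a) \<cdot>\<^sub>q q"
  proof cases
    case 1
    then show ?thesis using x[of 1] x[of "- a"] c by (simp add: qscale_add qscale_scale mult.commute)
  next
    case 2
    have "c * - a = (a * a) * y" using c 2 by (simp add: ac_simps)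
    then have "(c * - a) \<cdot>\<^sub>q q = q" using y[OF 2(2), of "a * a"] qscale_square[OF a] by simp
    moreover have "c \<cdot>\<^sub>q q = (- a) \<cdot>\<^sub>q q" using y[OF 2(2), of "- a"] c 2 by simp
    ultimately show ?thesis by (simp add: qscale_add qscale_scale add.commute)
  next
    case 3
    have "q + (- a) \<cdot>\<^sub>q q = x \<cdot>\<^sub>q q + (- a * y) \<cdot>\<^sub>q q"
      using x[of 1] y[of "- a"] 3 by simp
    also have "\<dots> = c \<cdot>\<^sub>q q + (c * (x * (- a * y))) \<cdot>\<^sub>q q"
      using scaled_pair[of x "- a * y" q] c c0 by simp
    also have "c * (x * (- a * y)) = ((c * - a) * x) * y" by (simp add: ac_simps)
    also have "\<dots> \<cdot>\<^sub>q q = (c * - a) \<cdot>\<^sub>q q" by (simp only: x[OF 3(1)] y[OF 3(2)])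
    finally have "q + (- a) \<cdot>\<^sub>q q = c \<cdot>\<^sub>q (q + (- a) \<cdot>\<^sub>q q)"
      unfolding qscale_add qscale_scale .
    then show ?thesis by (rule sym)
  qed
qed

lemma round_pfister: "round_form q \<Longrightarrow> 0 \<notin> set as \<Longrightarrow> round_form (pfister as q)"
  by (induction as) (simp_all add: round_double)

text \<open>
  If \<open>q = c p\<close> represents \<open>1\<close>, then \<open>1/c\<close> is a value of \<open>p\<close>, hence a similarity factor of \<open>p\<close>.
\<close>

lemma round_scaled:
  assumes q: "round_form q" and p: "round_form p" and eq: "q = c \<cdot>\<^sub>q p" and c: "c \<noteq> 0"
  shows "q = p"
proof -
  obtain y where y: "y \<in> qvals p" "1 = c * y"
    using round_formD(2)[OF q] unfolding eq qvals_scale by auto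
  then have "p = y \<cdot>\<^sub>q p" using round_formD(3)[OF p y(1)] by (metis mult_zero_right zero_neq_one)
  then have "q = (c * y) \<cdot>\<^sub>q p" using eq by (metis qscale_scale)
  then show ?thesis using y by simp
qed

text \<open>
  The complement of \<open>q\<close> in \<open>\<langle>\<langle>a\<^sub>1, \<dots>, a\<^sub>r\<rangle>\<rangle> \<otimes> q\<close> up to sign, see \<open>pfister_pure_part\<close>. The sign
  is chosen such that the values are possible slots: for \<open>r = 1\<close> the pure part is \<open>a\<^sub>1 q\<close>.
\<close>

fun pure_part :: "'a::field list \<Rightarrow> 'a qform \<Rightarrow> 'a qform" where
  "pure_part [] q = 0"
| "pure_part (a # as) q = pure_part as q + a \<cdot>\<^sub>q pfister as q"

lemma pfister_pure_part: "pfister as q = q + (- 1) \<cdot>\<^sub>q pure_part as q"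
proof (induction as)
  case Nil
  have "(- 1) \<cdot>\<^sub>q (0 :: 'a qform) = 0"
    by transfer (auto intro!: qf_isometric_eqvI[of _ 0] simp: qf_eval_def)
  then show ?case by simp
next
  case (Cons a as)
  have "pfister (a # as) q = pfister as q + (- 1 * a) \<cdot>\<^sub>q pfister as q" by simp
  also have "\<dots> = q + (- 1) \<cdot>\<^sub>q pure_part as q + (- 1 * a) \<cdot>\<^sub>q pfister as q" by (subst Cons.IH) simp
  finally show ?case by (simp add: qscale_add qscale_scale add.assoc)
qed

text \<open>
  The isometry of \<open>scaled_pair\<close> for \<open>\<langle>-u, -v\<rangle>\<close> inside \<open>\<langle>\<langle>u, v\<rangle>\<rangle> = \<langle>1, -u, -v, uv\<rangle>\<close>.
\<close>

lemma pfister_slot_exchange: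
  assumes "u + v \<noteq> 0"
  shows "pfister [u, v] q = pfister [u + v, - (u * v)] q"
proof -
  have 1: "(- u) \<cdot>\<^sub>q q + (- v) \<cdot>\<^sub>q q = (- (u + v)) \<cdot>\<^sub>q q + (- (u + v) * (u * v)) \<cdot>\<^sub>q q"
  proof -
    have sum: "- u + - v = - (u + v)" by simp
    then have "- u + - v \<noteq> 0" using assms by (metis neg_equal_0_iff_equal)
    from scaled_pair[OF this, of q] show ?thesis unfolding sum by simp
  qed
  have "pfister [u, v] q = q + ((- u) \<cdot>\<^sub>q q + (- v) \<cdot>\<^sub>q q) + (u * v) \<cdot>\<^sub>q q"
    by (simp add: qscale_add qscale_scale ac_simps)
  also have "\<dots> = pfister [u + v, - (u * v)] q"
    unfolding 1 by (simp add: qscale_add qscale_scale ac_simps)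
  finally show ?thesis .
qed

text \<open>
  A value of the pure part of \<open>\<langle>\<langle>a, a\<^sub>2, \<dots>\<rangle>\<rangle> \<otimes> q\<close> is \<open>c = x + a y\<close>, where \<open>x\<close> is a value of the pure
  part of \<open>\<langle>\<langle>a\<^sub>2, \<dots>\<rangle>\<rangle> \<otimes> q\<close> and \<open>y\<close> is a value of this form itself. By induction \<open>x\<close> can be made
  a slot of the latter if it is nonzero, and \<open>a\<close> can be replaced by \<open>a y\<close> if \<open>y\<close> is nonzero, by roundness. Exchanging the slots
  \<open>a y\<close> and \<open>x\<close> then produces the slot \<open>a y + x = c\<close>.
\<close>

lemma pure_part_slot:
  assumes q: "round_form q" and "0 \<notin> set as" and "c \<in> qvals (pure_part as q)" and "c \<noteq> 0"
  shows "\<exists>as'. 0 \<notin> set as' \<and> length as = Suc (length as') \<and> pfister as q = pfister (c # as') q"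
  using assms(2-)
proof (induction as arbitrary: c)
  case Nil
  have "qvals (0 :: 'a qform) = {0}"
    by transfer (auto simp: qf_values_def qf_eval_def scalar_prod_def image_iff intro!: exI[of _ "0\<^sub>v 0"])
  then show ?case using Nil by simp
next
  case (Cons a as)
  define p where "p = pfister as q"
  have p: "round_form p" using round_pfister[OF q] Cons.prems unfolding p_def by simp
  have a: "a \<noteq> 0" "0 \<notin> set as" using Cons.prems by auto
  obtain x y where x: "x \<in> qvals (pure_part as q)" and y: "y \<in> qvals p" and c: "c = x + a * y"
    using Cons.prems(2) unfolding p_def by (auto simp: qvals_add qvals_scale)
  have ay: "pfister (a # as) q = pfister ((a * y) # as) q" if "y \<noteq> 0"
    using qscale_absorb[OF p y that, of "- a"] by (simp add: p_def[symmetric])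
  show ?case
  proof (cases "x = 0")
    case True
    with c Cons.prems have "y \<noteq> 0" "c = a * y" by auto
    then show ?thesis using ay a by (intro exI[of _ as]) simp
  next
    case False
    then obtain bs where bs: "0 \<notin> set bs" "length as = Suc (length bs)" "pfister as q = pfister (x # bs) q"
      using Cons.IH[OF a(2) x] by blast
    show ?thesis
    proof (cases "y = 0")
      case True
      have "pfister (a # as) q = pfister [a] (pfister (x # bs) q)" using bs by simp
      also have "\<dots> = pfister [a] (pfister [x] (pfister bs q))" by simp
      also have "\<dots> = pfister [x] (pfister [a] (pfister bs q))" by (rule pfister_commute)
      finally have "pfister (a # as) q = pfister (c # a # bs) q" using c True by simp
      then show ?thesis using bs a by (intro exI[of _ "a # bs"]) simp
    next
      case False
      have "pfister (a # as) q = pfister [a * y, x] (pfister bs q)" using ay[OF False] bs by simp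
      also have "\<dots> = pfister [c, - (a * y * x)] (pfister bs q)"
        using pfister_slot_exchange[of "a * y" x "pfister bs q"] Cons.prems(3) unfolding c add.commute[of x] by blast
      finally show ?thesis using bs a False \<open>x \<noteq> 0\<close>
        by (intro exI[of _ "- (a * y * x) # bs"]) simp
    qed
  qed
qed

section \<open>Products of linked Pfister multiples\<close>

text \<open>
  A form that absorbs all nonzero scalars satisfies \<open>\<langle>\<langle>a\<rangle>\<rangle> \<otimes> q = q + q\<close>, and \<open>q + q\<close> absorbs them again.
  Only the number of slots matters. This applies to isotropic round forms.
\<close>

lemma pfister_universal:
  assumes "\<And>c. c \<noteq> 0 \<Longrightarrow> c \<cdot>\<^sub>q q = q" "0 \<notin> set as" "0 \<notin> set bs" "length as = length bs"
  shows "pfister as q = pfister bs q"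
proof -
  define dbl where "dbl n = ((\<lambda>p. p + p) ^^ n) q" for n
  have scale: "c \<cdot>\<^sub>q dbl n = dbl n" if "c \<noteq> 0" for c n
    using assms(1)[OF that] by (induction n) (simp_all add: dbl_def qscale_add)
  have "pfister cs q = dbl (length cs)" if "0 \<notin> set cs" for cs
    using that
  proof (induction cs)
    case (Cons c cs)
    then have "pfister (c # cs) q = dbl (length cs) + dbl (length cs)" using scale[of "- c"] by simp
    then show ?case by (simp add: dbl_def)
  qed (simp add: dbl_def)
  then show ?thesis using assms by simp
qed

text \<open>
  In the Witt group \<open>\<langle>\<langle>a\<rangle>\<rangle> \<otimes> p - \<langle>\<langle>c\<rangle>\<rangle> \<otimes> p = -a \<langle>\<langle>ac\<rangle>\<rangle> \<otimes> p\<close>, so the given forms determine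
  \<open>\<langle>\<langle>ac\<rangle>\<rangle> \<otimes> p\<close> up to similarity and hence, by \<open>round_scaled\<close>, up to isometry. They then also
  determine \<open>\<langle>\<langle>a, c\<rangle>\<rangle> \<otimes> p = \<langle>\<langle>a\<rangle>\<rangle> \<otimes> p + \<langle>\<langle>c\<rangle>\<rangle> \<otimes> p - \<langle>\<langle>ac\<rangle>\<rangle> \<otimes> p\<close>.
\<close>

lemma linked_one_fold_product:
  assumes p: "round_form p" and m: "round_form m" and nz: "a \<noteq> 0" "b \<noteq> 0" "c \<noteq> 0" "d \<noteq> 0"
    and 1: "pfister [a] p = pfister [b] m" and 2: "pfister [c] p = pfister [d] m" and dim: "qdim p = qdim m"
  shows "pfister [a] (pfister [c] p) = pfister [b] (pfister [d] m)"
proof -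
  \<comment> \<open>The Witt class of the difference of two one-fold multiples of \<open>s\<close>.\<close>
  have diff: "pfister [x] s + (-1) \<cdot>\<^sub>q pfister [y] s = hyperbolic (qdim s) + (- x) \<cdot>\<^sub>q pfister [x * y] s"
    if "nonsingular s" "x \<noteq> 0" for x y and s :: "'a qform"
  proof -
    have "(x * (x * y)) \<cdot>\<^sub>q s = y \<cdot>\<^sub>q (x * x) \<cdot>\<^sub>q s"
      by (simp add: qscale_scale ac_simps)
    then have "(x * (x * y)) \<cdot>\<^sub>q s = y \<cdot>\<^sub>q s" unfolding qscale_square[OF that(2)] .
    then show ?thesis
      unfolding add_negative[OF that(1), symmetric] by (simp add: qscale_add qscale_scale ac_simps)
  qed
  have "hyperbolic (qdim m) + (- a) \<cdot>\<^sub>q pfister [a * c] p = hyperbolic (qdim m) + (- b) \<cdot>\<^sub>q pfister [b * d] m"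
    using diff[OF round_formD(1)[OF p] nz(1), of c] diff[OF round_formD(1)[OF m] nz(2), of d]
    unfolding 1 2 dim by simp
  then have "(- a) \<cdot>\<^sub>q pfister [a * c] p = (- b) \<cdot>\<^sub>q pfister [b * d] m" by (rule cancel_hyperbolic)
  from arg_cong[OF this, of "\<lambda>r. inverse (- a) \<cdot>\<^sub>q r"]
  have "pfister [a * c] p = (inverse (- a) * - b) \<cdot>\<^sub>q pfister [b * d] m"
    using nz(1) by (simp only: qscale_scale) simp
  then have eq: "pfister [a * c] p = pfister [b * d] m"
    by (rule round_scaled[rotated 2]) (use nz in \<open>simp_all add: round_pfister p m del: pfister.simps\<close>)
  \<comment> \<open>The summands \<open>xy s\<close> and \<open>-xy s\<close> on the left make up the hyperbolic planes.\<close>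
  have sum: "pfister [x * y] s + pfister [x] (pfister [y] s) = pfister [x] s + pfister [y] s + hyperbolic (qdim s)"
    if "nonsingular s" "x \<noteq> 0" "y \<noteq> 0" for x y and s :: "'a qform"
  proof -
    have "hyperbolic (qdim s) = (x * y) \<cdot>\<^sub>q s + (- (x * y)) \<cdot>\<^sub>q s"
      using add_negative[OF nonsingular_scale[OF that(1), of "x * y"]] that
      by (simp add: qscale_scale)
    then show ?thesis by (simp add: qscale_add qscale_scale ac_simps)
  qed
  have "pfister [a * c] p + pfister [a] (pfister [c] p) = pfister [a * c] p + pfister [b] (pfister [d] m)"
    using sum[OF round_formD(1)[OF p] nz(1,3)] sum[OF round_formD(1)[OF m] nz(2,4)] unfolding 1 2 eq dim
    by (rule trans[OF _ sym])
  then show ?thesis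
    by (rule witt_cancellation[rotated]) (rule round_formD(1)[OF round_pfister[OF p]], use nz in simp)
qed

text \<open>
  With at least two slots, \<open>p\<close> and \<open>m\<close> have together at most half the dimension of the whole form. Their
  complements therefore have a common nonzero value, and up to sign it is a slot on both sides by \<open>pure_part_slot\<close>.
\<close>

lemma common_slot:
  assumes p: "round_form p" and m: "round_form m" and dim: "qdim p = qdim m"
    and nz: "0 \<notin> set as" "0 \<notin> set bs" and len: "length as = length bs" "length as \<ge> 2"
    and eq: "pfister as p = pfister bs m" and aniso: "anisotropic (pfister as p)"
  obtains c as' bs' where "c \<noteq> 0" "0 \<notin> set as'" "0 \<notin> set bs'" "length as = Suc (length as')"
    "length bs = Suc (length bs')" "pfister as p = pfister (c # as') p" "pfister bs m = pfister (c # bs') m"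
proof -
  have "qdim p > 0"
  proof (rule ccontr)
    assume "\<not> qdim p > 0"
    then have "qvals p \<subseteq> {0}"
      by transfer (auto simp: qf_values_def qf_eval_def scalar_prod_def)
    then show False using round_formD(2)[OF p] by auto
  qed
  have eq': "p + (- 1) \<cdot>\<^sub>q pure_part as p = m + (- 1) \<cdot>\<^sub>q pure_part bs m"
    using eq pfister_pure_part[of as p] pfister_pure_part[of bs m] by simp
  have "qdim p + qdim m < 4 * qdim p" using \<open>qdim p > 0\<close> dim by simp
  also have "\<dots> \<le> 2 ^ length as * qdim p"
    using power_increasing[OF len(2), of "2 :: nat"] by (intro mult_le_mono1) simp
  also have "\<dots> = qdim (p + (- 1) \<cdot>\<^sub>q pure_part as p)"
    unfolding pfister_pure_part[symmetric] by (rule qdim_pfister[symmetric])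
  finally have "qdim p + qdim m < qdim (p + (- 1) \<cdot>\<^sub>q pure_part as p)" .
  then obtain d where d: "d \<noteq> 0" "d \<in> qvals ((- 1) \<cdot>\<^sub>q pure_part as p)" "d \<in> qvals ((- 1) \<cdot>\<^sub>q pure_part bs m)"
    using common_complement_value[OF eq'] aniso unfolding pfister_pure_part[symmetric] by blast
  then have "- d \<in> qvals (pure_part as p)" "- d \<in> qvals (pure_part bs m)" "- d \<noteq> 0"
    unfolding qvals_scale by auto
  then show ?thesis using pure_part_slot[OF p nz(1)] pure_part_slot[OF m nz(2)] that[of "- d"] by blast
qed

text \<open>
  One slot fewer in \<open>as\<close> and \<open>bs\<close>, whatever the number of slots in \<open>cs\<close> and \<open>ds\<close>. Stating the step
  separately allows its use with the two pairs of lists exchanged.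
\<close>

lemma linked_pfister_product_step:
  assumes IH: "\<And>p m as' bs'. round_form p \<Longrightarrow> round_form m \<Longrightarrow> qdim p = qdim m \<Longrightarrow>
      0 \<notin> set as' \<Longrightarrow> 0 \<notin> set bs' \<Longrightarrow> length as' = length bs' \<Longrightarrow> length as' < length as \<Longrightarrow>
      pfister as' p = pfister bs' m \<Longrightarrow> pfister cs p = pfister ds m \<Longrightarrow> pfister as' (pfister cs p) = pfister bs' (pfister ds m)"
    and p: "round_form p" and m: "round_form m" and dim: "qdim p = qdim m"
    and nz: "0 \<notin> set as" "0 \<notin> set bs" "0 \<notin> set cs" "0 \<notin> set ds"
    and len: "length as = length bs" "length cs = length ds" "length as \<ge> 2"
    and eq1: "pfister as p = pfister bs m" and eq2: "pfister cs p = pfister ds m"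
  shows "pfister as (pfister cs p) = pfister bs (pfister ds m)"
proof (cases "anisotropic (pfister as p)")
  case False
  define q where "q = pfister as p"
  have q: "round_form q" unfolding q_def using p nz(1) by (rule round_pfister)
  have "qvals q = UNIV"
    using universal_if_isotropic[OF round_formD(1)[OF q]] False unfolding q_def by blast
  then have "c \<cdot>\<^sub>q q = q" if "c \<noteq> 0" for c using round_formD(3)[OF q _ that] by blast
  then have "pfister cs q = pfister ds q" using nz(3,4) len(2) by (rule pfister_universal)
  then show ?thesis
    unfolding q_def by (simp only: pfister_commute[of as cs p] pfister_commute[of bs ds m] eq1)
next
  case True
  obtain c as' bs' where c: "c \<noteq> 0" "0 \<notin> set as'" "0 \<notin> set bs'" "length as = Suc (length as')"
    "length bs = Suc (length bs')" "pfister as p = pfister (c # as') p" "pfister bs m = pfister (c # bs') m"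
    using common_slot[OF p m dim nz(1,2) len(1,3) eq1 True] by blast
  have "pfister as' (pfister cs (pfister [c] p)) = pfister bs' (pfister ds (pfister [c] m))"
  proof (rule IH)
    show "round_form (pfister [c] p)" "round_form (pfister [c] m)" using c(1) by (intro round_pfister p m; simp)+
    \<comment> \<open>The common slot moves from the bilinear factor to the forms \<open>p\<close> and \<open>m\<close>.\<close>
    show "pfister as' (pfister [c] p) = pfister bs' (pfister [c] m)" unfolding pfister_absorb_slot using eq1 c by simp
    show "pfister cs (pfister [c] p) = pfister ds (pfister [c] m)"
      by (simp only: pfister_commute[of cs "[c]" p] pfister_commute[of ds "[c]" m] eq2)
  qed (use c dim len in auto)
  moreover have "pfister as (pfister cs p) = pfister as' (pfister cs (pfister [c] p))"
    by (simp only: pfister_commute[of as cs p] c(6) pfister_absorb_slot[of as' c p, symmetric] pfister_commute[of cs as' "pfister [c] p"])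
  moreover have "pfister bs (pfister ds m) = pfister bs' (pfister ds (pfister [c] m))"
    by (simp only: pfister_commute[of bs ds m] c(7) pfister_absorb_slot[of bs' c m, symmetric] pfister_commute[of ds bs' "pfister [c] m"])
  ultimately show ?thesis by simp
qed

text \<open>
  An empty pair of lists forces \<open>p = m\<close>, and the other identity is the claim. One slot in each
  list is \<open>linked_one_fold_product\<close>. In all other cases one of the pairs has at least two slots.
\<close>

lemma linked_pfister_product:
  assumes "round_form p" "round_form m" "qdim p = qdim m"
    and "0 \<notin> set as" "0 \<notin> set bs" "0 \<notin> set cs" "0 \<notin> set ds"
    and "length as = length bs" "length cs = length ds"
    and "pfister as p = pfister bs m" "pfister cs p = pfister ds m"
  shows "pfister as (pfister cs p) = pfister bs (pfister ds m)"
  using assms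
proof (induction "length as + length cs" arbitrary: p m as bs cs ds rule: less_induct)
  case less
  consider "length as = 0" | "length cs = 0" | "length as \<ge> 2" | "length cs \<ge> 2"
    | "length as = 1" "length cs = 1" by linarith
  then show ?case
  proof cases
    case 1
    then show ?thesis using less.prems by simp
  next
    case 2
    then show ?thesis using less.prems by simp
  next
    case 3
    show ?thesis
      by (rule linked_pfister_product_step[OF _ less.prems(1-9) 3 less.prems(10,11)])
        (rule less.hyps, use less.prems in auto)
  next
    case 4
    have "pfister cs (pfister as p) = pfister ds (pfister bs m)"
    proof (rule linked_pfister_product_step[OF _ less.prems(1-3,6,7,4,5,9,8) 4 less.prems(11,10)])
      fix p m cs' ds'
      assume "round_form p" "round_form m" "qdim p = qdim m" "0 \<notin> set cs'" "0 \<notin> set ds'"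
        "length cs' = length ds'" "length cs' < length cs" "pfister cs' p = pfister ds' m" "pfister as p = pfister bs m"
      then have "pfister as (pfister cs' p) = pfister bs (pfister ds' m)"
        by (intro less.hyps) (use less.prems in auto)
      then show "pfister cs' (pfister as p) = pfister ds' (pfister bs m)"
        unfolding pfister_commute[of as cs' p] pfister_commute[of bs ds' m] .
    qed
    then show ?thesis unfolding pfister_commute[of as cs p] pfister_commute[of bs ds m] .
  next
    case 5
    then obtain a b c d where "as = [a]" "bs = [b]" "cs = [c]" "ds = [d]"
      using less.prems(8,9) by (metis One_nat_def length_0_conv length_Suc_conv)
    with less.prems linked_one_fold_product[of p m a b c d] show ?thesis by auto
  qed
qed

section \<open>Tensor products with diagonal bilinear forms\<close>

lemma qf_tensor_Nil: "[] \<otimes>\<^sub>q A = 0\<^sub>m 0 0"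
  unfolding qf_tensor_def by simp

lemma qf_tensor_Cons: "(b # bs) \<otimes>\<^sub>q A = (b \<cdot>\<^sub>m A) \<oplus>\<^sub>q (bs \<otimes>\<^sub>q A)"
  unfolding qf_tensor_def qf_sum_def by (simp add: Let_def)

lemma qf_tensor_carrier:
  "A \<in> carrier_mat n n \<Longrightarrow> bs \<otimes>\<^sub>q A \<in> carrier_mat (length bs * n) (length bs * n)"
proof (induction bs)
  case (Cons b bs)
  then show ?case
    using qf_sum_carrier[of "b \<cdot>\<^sub>m A" n "bs \<otimes>\<^sub>q A" "length bs * n"] by (simp add: qf_tensor_Cons)
qed (simp add: qf_tensor_Nil)

lemma qf_eval_coordinates:
  assumes "A \<in> carrier_mat n n" "x \<in> carrier_vec n"
  shows "qf_eval A x = (\<Sum>k<n. \<Sum>l<n. A $$ (k, l) * (x $ k * x $ l))"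
  using assms unfolding qf_eval_def
  by (auto simp: scalar_prod_def sum_distrib_left atLeast0LessThan ac_simps intro!: sum.cong)

lemma qf_eval_tensor:
  assumes A: "A \<in> carrier_mat n n" and "v \<in> carrier_vec (length bs * n)"
  shows "qf_eval (bs \<otimes>\<^sub>q A) v = (\<Sum>i<length bs. bs ! i * qf_eval A (vec n (\<lambda>k. v $ (i * n + k))))"
  using assms(2)
proof (induction bs arbitrary: v)
  case Nil
  then show ?case by (simp add: qf_tensor_Nil qf_eval_def scalar_prod_def)
next
  case (Cons b bs)
  then have "v \<in> carrier_vec (n + length bs * n)" by simp
  then obtain x y where v: "v = x @\<^sub>v y" and x: "x \<in> carrier_vec n" and y: "y \<in> carrier_vec (length bs * n)"
    by (rule carrier_vec_sumE)
  have x': "vec n (\<lambda>k. (x @\<^sub>v y) $ k) = x" using x y by (intro eq_vecI) auto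
  have y': "vec n (\<lambda>k. (x @\<^sub>v y) $ (n + i * n + k)) = vec n (\<lambda>k. y $ (i * n + k))"
    if i: "i < length bs" for i
  proof (rule eq_vecI)
    fix k assume "k < dim_vec (vec n (\<lambda>k. y $ (i * n + k)))"
    then have k: "k < n" by simp
    have "i * n + k < Suc i * n" using k by simp
    also have "\<dots> \<le> length bs * n" using i by (intro mult_le_mono1) simp
    finally show "vec n (\<lambda>k. (x @\<^sub>v y) $ (n + i * n + k)) $ k = vec n (\<lambda>k. y $ (i * n + k)) $ k"
      using k x y by (simp add: add.assoc)
  qed simp
  have "qf_eval ((b # bs) \<otimes>\<^sub>q A) v = b * qf_eval A x + qf_eval (bs \<otimes>\<^sub>q A) y"
    unfolding qf_tensor_Cons v
    using qf_eval_sum[OF _ qf_tensor_carrier[OF A] x y, of "b \<cdot>\<^sub>m A"] qf_eval_smult[OF A x] A by simp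
  then show ?case
    unfolding Cons.IH[OF y] v by (simp add: sum.lessThan_Suc_shift x' y' del: sum.lessThan_Suc)
qed

text \<open>
  If \<open>P\<close> is an isometry of the bilinear forms, then \<open>P \<otimes> I\<close> is one of the tensor products. In
  coordinates, position \<open>i n + k\<close> of a vector is entry \<open>k\<close> of its block \<open>v\<^sub>i\<close>. Expanding
  \<open>\<Sum>\<^sub>i b\<^sub>i Q(\<Sum>\<^sub>j P\<^sub>i\<^sub>j v\<^sub>j)\<close> gives the products \<open>v\<^sub>j \<bullet> A v\<^sub>h\<close> with the entries of \<open>P\<^sup>T B P\<close> as coefficients,
  and this matrix is diagonal with entries \<open>c\<^sub>j\<close>.
\<close>

lemma qf_tensor_cong:
  fixes A :: "'a::field mat"
  assumes A: "A \<in> carrier_mat n n" and iso: "bs \<simeq>\<^sub>b cs"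
  shows "bs \<otimes>\<^sub>q A \<simeq>\<^sub>q cs \<otimes>\<^sub>q A"
proof -
  define m where "m = length bs"
  obtain P where len: "length cs = m" and P: "P \<in> carrier_mat m m" and inv: "invertible_mat P"
    and gram: "P\<^sup>T * bf_gram bs * P = bf_gram cs"
    using iso unfolding bf_isometric_def m_def by auto
  have gram': "(\<Sum>i<m. bs ! i * (P $$ (i, j) * P $$ (i, h))) = (if j = h then cs ! j else 0)"
    if jh: "j < m" "h < m" for j h
  proof -
    have b: "bf_gram bs \<in> carrier_mat m m" unfolding bf_gram_def m_def by simp
    define X where "X = P\<^sup>T * bf_gram bs"
    have X: "X \<in> carrier_mat m m" unfolding X_def using P b by simp
    have 1: "X $$ (j, i) = P $$ (i, j) * bs ! i" if "i < m" for i
    proof -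
      have "X $$ (j, i) = (\<Sum>l<m. P $$ (l, j) * (if l = i then bs ! l else 0))"
        unfolding X_def using jh that P b by (auto simp: scalar_prod_def atLeast0LessThan bf_gram_def m_def mat_diag_def intro!: sum.cong)
      also have "\<dots> = (\<Sum>l<m. if l = i then P $$ (l, j) * bs ! l else 0)"
        by (rule sum.cong) auto
      finally show ?thesis using that by simp
    qed
    have "(X * P) $$ (j, h) = (\<Sum>i<m. X $$ (j, i) * P $$ (i, h))"
      using jh P X by (auto simp: scalar_prod_def atLeast0LessThan intro!: sum.cong)
    also have "\<dots> = (\<Sum>i<m. bs ! i * (P $$ (i, j) * P $$ (i, h)))"
      by (rule sum.cong) (auto simp: 1 ac_simps)
    finally show ?thesis
      unfolding X_def gram using jh len by (simp add: bf_gram_def mat_diag_def split: if_splits)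
  qed
  define R where "R = mat (m * n) (m * n)
    (\<lambda>(s, t). if s mod n = t mod n then P $$ (s div n, t div n) else 0)"
  have R: "R \<in> carrier_mat (m * n) (m * n)" unfolding R_def by simp
  have less: "i * n + k < m * n" if "i < m" "k < n" for i k
  proof -
    have "i * n + k < Suc i * n" using that by simp
    also have "\<dots> \<le> m * n" using that by (intro mult_le_mono1) simp
    finally show ?thesis .
  qed
  have R_index: "(R *\<^sub>v v) $ (i * n + k) = (\<Sum>j<m. P $$ (i, j) * v $ (j * n + k))"
    if v: "v \<in> carrier_vec (m * n)" and i: "i < m" and k: "k < n" for v i k
  proof -
    have "(R *\<^sub>v v) $ (i * n + k) = (\<Sum>t<m * n. (if k = t mod n then P $$ (i, t div n) else 0) * v $ t)"
      using v less[OF i k] k unfolding R_def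
      by (auto simp: scalar_prod_def atLeast0LessThan intro!: sum.cong)
    also have "\<dots> = (\<Sum>j<m. \<Sum>t = j * n..<j * n + n. (if k = t mod n then P $$ (i, t div n) else 0) * v $ t)"
      by (rule sum.nat_group[symmetric])
    also have "\<dots> = (\<Sum>j<m. P $$ (i, j) * v $ (j * n + k))"
    proof (rule sum.cong[OF refl])
      fix j
      define g where "g t = (if k = t mod n then P $$ (i, t div n) else 0) * v $ t" for t
      have "sum g {j * n..<j * n + n} = (\<Sum>l = 0..<n. g (l + j * n))"
        using sum.shift_bounds_nat_ivl[of g 0 "j * n" n] by (simp add: add.commute)
      also have "\<dots> = (\<Sum>l = 0..<n. if k = l then P $$ (i, j) * v $ (j * n + l) else 0)"
        by (intro sum.cong) (auto simp: g_def add.commute)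
      finally show "(\<Sum>t = j * n..<j * n + n. (if k = t mod n then P $$ (i, t div n) else 0) * v $ t) =
          P $$ (i, j) * v $ (j * n + k)"
        using k unfolding g_def by simp
    qed
    finally show ?thesis .
  qed
  show ?thesis
  proof (rule qf_isometricI[OF _ _ R])
    show "bs \<otimes>\<^sub>q A \<in> carrier_mat (m * n) (m * n)" "cs \<otimes>\<^sub>q A \<in> carrier_mat (m * n) (m * n)"
      using qf_tensor_carrier[OF A] len unfolding m_def by metis+
    fix v :: "'a vec" assume v: "v \<in> carrier_vec (m * n)"
    show "v = 0\<^sub>v (m * n)" if 0: "R *\<^sub>v v = 0\<^sub>v (m * n)"
    proof (rule eq_vecI)
      fix t assume "t < dim_vec (0\<^sub>v (m * n) :: 'a vec)"
      then have t: "t < m * n" by simp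
      then have n: "0 < n" by (cases n) auto
      define k j where "k = t mod n" and "j = t div n"
      have k: "k < n" and j: "j < m" and t_eq: "t = j * n + k"
        using t n unfolding k_def j_def by (auto simp: less_mult_imp_div_less)
      have Pw: "P *\<^sub>v vec m (\<lambda>j. v $ (j * n + k)) = 0\<^sub>v m"
      proof (rule eq_vecI)
        fix i assume "i < dim_vec (0\<^sub>v m :: 'a vec)"
        then have i: "i < m" by simp
        have "(P *\<^sub>v vec m (\<lambda>j. v $ (j * n + k))) $ i = (\<Sum>j<m. P $$ (i, j) * v $ (j * n + k))"
          using P i by (auto simp: scalar_prod_def atLeast0LessThan intro!: sum.cong)
        also have "\<dots> = 0" using R_index[OF v i k] 0 less[OF i k] by simp
        finally show "(P *\<^sub>v vec m (\<lambda>j. v $ (j * n + k))) $ i = 0\<^sub>v m $ i" using i by simp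
      qed (use P in simp)
      obtain S where S: "S \<in> carrier_mat m m" "S * P = 1\<^sub>m m"
        using invertible_inverseE[OF P inv] by blast
      have "vec m (\<lambda>j. v $ (j * n + k)) = (S * P) *\<^sub>v vec m (\<lambda>j. v $ (j * n + k))" using S by simp
      also have "\<dots> = S *\<^sub>v (P *\<^sub>v vec m (\<lambda>j. v $ (j * n + k)))"
        by (rule assoc_mult_mat_vec[OF S(1) P]) simp
      also have "\<dots> = 0\<^sub>v m" unfolding Pw using S by simp
      finally have "vec m (\<lambda>j. v $ (j * n + k)) $ j = 0\<^sub>v m $ j" by simp
      then show "v $ t = 0\<^sub>v (m * n) $ t" using j t t_eq by simp
    qed (use v in simp)
    have "qf_eval (bs \<otimes>\<^sub>q A) (R *\<^sub>v v) =
        (\<Sum>i<m. bs ! i * (\<Sum>k<n. \<Sum>l<n. A $$ (k, l) *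
          ((\<Sum>j<m. P $$ (i, j) * v $ (j * n + k)) * (\<Sum>h<m. P $$ (i, h) * v $ (h * n + l)))))"
    proof -
      have "R *\<^sub>v v \<in> carrier_vec (length bs * n)" using R v unfolding m_def by simp
      from qf_eval_tensor[OF A this]
      have "qf_eval (bs \<otimes>\<^sub>q A) (R *\<^sub>v v) = (\<Sum>i<m. bs ! i * (\<Sum>k<n. \<Sum>l<n. A $$ (k, l) *
          ((R *\<^sub>v v) $ (i * n + k) * (R *\<^sub>v v) $ (i * n + l))))"
        unfolding m_def[symmetric] by (simp add: qf_eval_coordinates[OF A])
      also have "\<dots> = (\<Sum>i<m. bs ! i * (\<Sum>k<n. \<Sum>l<n. A $$ (k, l) *
          ((\<Sum>j<m. P $$ (i, j) * v $ (j * n + k)) * (\<Sum>h<m. P $$ (i, h) * v $ (h * n + l)))))"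
        by (intro sum.cong refl arg_cong2[of _ _ _ _ "(*)"]) (simp_all only: R_index[OF v] lessThan_iff)
      finally show ?thesis .
    qed
    also have "\<dots> = (\<Sum>k<n. \<Sum>l<n. A $$ (k, l) *
        (\<Sum>j<m. \<Sum>h<m. (\<Sum>i<m. bs ! i * (P $$ (i, j) * P $$ (i, h))) * (v $ (j * n + k) * v $ (h * n + l))))"
    proof -
      have *: "(\<Sum>i<m. bs ! i * (A $$ (k, l) *
            ((\<Sum>j<m. P $$ (i, j) * v $ (j * n + k)) * (\<Sum>h<m. P $$ (i, h) * v $ (h * n + l))))) =
          A $$ (k, l) * (\<Sum>j<m. \<Sum>h<m.
            (\<Sum>i<m. bs ! i * (P $$ (i, j) * P $$ (i, h))) * (v $ (j * n + k) * v $ (h * n + l)))" for k l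
      proof -
        have "(\<Sum>j<m. \<Sum>h<m. (\<Sum>i<m. bs ! i * (P $$ (i, j) * P $$ (i, h))) * (v $ (j * n + k) * v $ (h * n + l)))
           = (\<Sum>j<m. \<Sum>h<m. \<Sum>i<m. bs ! i * ((P $$ (i, j) * v $ (j * n + k)) * (P $$ (i, h) * v $ (h * n + l))))"
          unfolding sum_distrib_right by (intro sum.cong refl) (simp add: ac_simps)
        also have "\<dots> = (\<Sum>j<m. \<Sum>i<m. \<Sum>h<m. bs ! i * ((P $$ (i, j) * v $ (j * n + k)) * (P $$ (i, h) * v $ (h * n + l))))"
          by (rule sum.cong[OF refl]) (rule sum.swap)
        also have "\<dots> = (\<Sum>i<m. \<Sum>j<m. \<Sum>h<m. bs ! i * ((P $$ (i, j) * v $ (j * n + k)) * (P $$ (i, h) * v $ (h * n + l))))"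
          by (rule sum.swap)
        also have "\<dots> = (\<Sum>i<m. bs ! i * ((\<Sum>j<m. P $$ (i, j) * v $ (j * n + k)) * (\<Sum>h<m. P $$ (i, h) * v $ (h * n + l))))"
          unfolding sum_product unfolding sum_distrib_left ..
        finally show ?thesis by (simp add: sum_distrib_left ac_simps)
      qed
      have "(\<Sum>i<m. bs ! i * (\<Sum>k<n. \<Sum>l<n. A $$ (k, l) *
          ((\<Sum>j<m. P $$ (i, j) * v $ (j * n + k)) * (\<Sum>h<m. P $$ (i, h) * v $ (h * n + l))))) =
        (\<Sum>i<m. \<Sum>k<n. \<Sum>l<n. bs ! i * (A $$ (k, l) *
          ((\<Sum>j<m. P $$ (i, j) * v $ (j * n + k)) * (\<Sum>h<m. P $$ (i, h) * v $ (h * n + l)))))"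
        unfolding sum_distrib_left ..
      also have "\<dots> = (\<Sum>k<n. \<Sum>i<m. \<Sum>l<n. bs ! i * (A $$ (k, l) *
          ((\<Sum>j<m. P $$ (i, j) * v $ (j * n + k)) * (\<Sum>h<m. P $$ (i, h) * v $ (h * n + l)))))"
        by (rule sum.swap)
      also have "\<dots> = (\<Sum>k<n. \<Sum>l<n. \<Sum>i<m. bs ! i * (A $$ (k, l) *
          ((\<Sum>j<m. P $$ (i, j) * v $ (j * n + k)) * (\<Sum>h<m. P $$ (i, h) * v $ (h * n + l)))))"
        by (rule sum.cong[OF refl]) (rule sum.swap)
      finally show ?thesis unfolding * .
    qed
    also have "\<dots> = (\<Sum>k<n. \<Sum>l<n. A $$ (k, l) * (\<Sum>j<m. cs ! j * (v $ (j * n + k) * v $ (j * n + l))))"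
    proof -
      have "(\<Sum>h<m. (\<Sum>i<m. bs ! i * (P $$ (i, j) * P $$ (i, h))) * (v $ (j * n + k) * v $ (h * n + l))) =
          cs ! j * (v $ (j * n + k) * v $ (j * n + l))" if j: "j < m" for j k l
      proof -
        have "(\<Sum>h<m. (\<Sum>i<m. bs ! i * (P $$ (i, j) * P $$ (i, h))) * (v $ (j * n + k) * v $ (h * n + l))) =
            (\<Sum>h<m. if j = h then cs ! j * (v $ (j * n + k) * v $ (h * n + l)) else 0)"
          by (rule sum.cong) (auto simp: gram'[OF j])
        then show ?thesis using j by simp
      qed
      then show ?thesis by simp
    qed
    also have "\<dots> = (\<Sum>k<n. \<Sum>l<n. \<Sum>j<m. cs ! j * (A $$ (k, l) * (v $ (j * n + k) * v $ (j * n + l))))"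
      by (simp add: sum_distrib_left ac_simps)
    also have "\<dots> = (\<Sum>k<n. \<Sum>j<m. \<Sum>l<n. cs ! j * (A $$ (k, l) * (v $ (j * n + k) * v $ (j * n + l))))"
      by (rule sum.cong[OF refl]) (rule sum.swap)
    also have "\<dots> = (\<Sum>j<m. \<Sum>k<n. \<Sum>l<n. cs ! j * (A $$ (k, l) * (v $ (j * n + k) * v $ (j * n + l))))"
      by (rule sum.swap)
    also have "\<dots> = qf_eval (cs \<otimes>\<^sub>q A) v"
      using v qf_eval_tensor[OF A, of v cs] unfolding len
      by (simp add: qf_eval_coordinates[OF A] sum_distrib_left)
    finally show "qf_eval (bs \<otimes>\<^sub>q A) (R *\<^sub>v v) = qf_eval (cs \<otimes>\<^sub>q A) v" .
  qed
qed

section \<open>Tensor products of isometry classes\<close>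

lemma isometricD:
  assumes "A \<simeq>\<^sub>q B"
  shows "A \<simeq>\<^sub>q A" "B \<simeq>\<^sub>q B" "abs_qform A = abs_qform B"
  using Quotient_rel[OF Quotient_qform, of A B] assms by blast+

lemma isometric_absI:
  "A \<simeq>\<^sub>q A \<Longrightarrow> B \<simeq>\<^sub>q B \<Longrightarrow> abs_qform A = abs_qform B \<Longrightarrow> A \<simeq>\<^sub>q B"
  using Quotient_rel[OF Quotient_qform, of A B] by blast

lemma abs_qform_sum: "A \<simeq>\<^sub>q A \<Longrightarrow> B \<simeq>\<^sub>q B \<Longrightarrow> abs_qform (A \<oplus>\<^sub>q B) = abs_qform A + abs_qform B"
  by (rule plus_qform.abs_eq[symmetric])

lemma abs_qform_smult: "A \<simeq>\<^sub>q A \<Longrightarrow> abs_qform (c \<cdot>\<^sub>m A) = c \<cdot>\<^sub>q abs_qform A"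
  by (rule qscale.abs_eq[symmetric])

text \<open>
  The operation that \<^const>\<open>qf_tensor\<close> induces on isometry classes of quadratic forms.
\<close>

definition tensor :: "'a::field list \<Rightarrow> 'a qform \<Rightarrow> 'a qform" where
  "tensor bs q = (\<Sum>b\<leftarrow>bs. b \<cdot>\<^sub>q q)"

lemma abs_qform_tensor:
  assumes "A \<simeq>\<^sub>q A"
  shows "bs \<otimes>\<^sub>q A \<simeq>\<^sub>q bs \<otimes>\<^sub>q A" and "abs_qform (bs \<otimes>\<^sub>q A) = tensor bs (abs_qform A)"
proof -
  have sq: "cs \<otimes>\<^sub>q A \<simeq>\<^sub>q cs \<otimes>\<^sub>q A" for cs
    by (rule qf_isometric_refl[OF qf_tensor_carrier[OF qf_isometric_self_carrier[OF assms]]])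
  then show "bs \<otimes>\<^sub>q A \<simeq>\<^sub>q bs \<otimes>\<^sub>q A" .
  show "abs_qform (bs \<otimes>\<^sub>q A) = tensor bs (abs_qform A)"
  proof (induction bs)
    case Nil
    then show ?case by (simp add: qf_tensor_Nil tensor_def zero_qform.abs_eq)
  next
    case (Cons b bs)
    then show ?case
      unfolding qf_tensor_Cons
      by (simp add: abs_qform_sum[OF qf_smult_cong[OF assms] sq] abs_qform_smult[OF assms] tensor_def)
  qed
qed

lemma tensor_scale: "tensor bs (c \<cdot>\<^sub>q q) = c \<cdot>\<^sub>q tensor bs q"
proof (induction bs)
  case Nil
  have "c \<cdot>\<^sub>q (0 :: 'a qform) = 0"
    by transfer (auto intro!: qf_isometric_eqvI[of _ 0] simp: qf_eval_def scalar_prod_def)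
  then show ?case by (simp add: tensor_def)
next
  case (Cons b bs)
  then show ?case by (simp add: tensor_def qscale_add qscale_scale mult.commute)
qed

lemma tensor_bf_tensor: "tensor (bs \<otimes>\<^sub>b cs) q = tensor bs (tensor cs q)"
proof (induction bs)
  case (Cons b bs)
  have "(\<Sum>c\<leftarrow>cs. (b * c) \<cdot>\<^sub>q q) = tensor cs (b \<cdot>\<^sub>q q)"
    unfolding tensor_def by (simp add: qscale_scale mult.commute)
  then show ?case
    using Cons by (simp add: bf_tensor_def tensor_def tensor_scale[unfolded tensor_def] o_def)
qed (simp add: bf_tensor_def tensor_def)

lemma tensor_pfister: "tensor (bf_pfister as) q = pfister as q"
proof (induction as)
  case Nil
  then show ?case by (simp add: bf_pfister_def tensor_def)
next
  case (Cons a as)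
  have "bf_pfister (a # as) = [1, - a] \<otimes>\<^sub>b bf_pfister as" unfolding bf_pfister_def by simp
  then show ?case
    using Cons by (simp add: tensor_bf_tensor) (simp add: tensor_def)
qed

lemma tensor_cong:
  assumes "bs \<simeq>\<^sub>b cs" shows "tensor bs q = tensor cs q"
proof (induction q rule: qform.abs_induct)
  case (1 A)
  have "bs \<otimes>\<^sub>q A \<simeq>\<^sub>q cs \<otimes>\<^sub>q A" by (rule qf_tensor_cong[OF qf_isometric_self_carrier[OF 1] assms])
  from isometricD(3)[OF this] show ?case unfolding abs_qform_tensor(2)[OF 1] .
qed

lemma bilinear_pfisterE:
  assumes "bilinear_pfister bs"
  obtains as where "0 \<notin> set as" "\<And>q. tensor bs q = pfister as q"
  using assms unfolding bilinear_pfister_def by (metis tensor_cong tensor_pfister)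

section \<open>Quadratic Pfister forms as Pfister multiples\<close>

lemma one_mat_self: "1\<^sub>m n \<simeq>\<^sub>q (1\<^sub>m n :: 'a::field mat)"
  by (rule qf_isometric_refl[OF one_carrier_mat])

lemma mat_diag_tensor: "mat_diag (length ds) (\<lambda>i. ds ! i) = ds \<otimes>\<^sub>q (1\<^sub>m 1 :: 'a::field mat)"
proof (induction ds)
  case Nil
  then show ?case by (intro eq_matI) (auto simp: qf_tensor_Nil mat_diag_def)
next
  case (Cons d ds)
  show ?case
    unfolding qf_tensor_Cons Cons.IH[symmetric]
    by (intro eq_matI) (auto simp: qf_sum_def mat_diag_def nth_Cons split: nat.split)
qed

lemma two_neq_zero:
  assumes "CHAR('a::field) \<noteq> 2" shows "(2 :: 'a) \<noteq> 0"
proof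
  assume "(2 :: 'a) = 0"
  then have "of_nat 2 = (0 :: 'a)" by simp
  then have "CHAR('a) dvd 2" by (simp only: of_nat_eq_0_iff_char_dvd)
  then have "CHAR('a) = 1 \<or> CHAR('a) = 2" using two_is_prime_nat by (metis prime_nat_iff)
  then show False using assms CHAR_not_1[where 'a = 'a] by simp
qed

lemma round_unit:
  assumes "CHAR('a::field) \<noteq> 2"
  shows "round_form (abs_qform (1\<^sub>m 1 :: 'a mat))"
proof -
  have eval: "qf_eval (1\<^sub>m 1) v = v $ 0 * v $ 0" if "v \<in> carrier_vec 1" for v :: "'a vec"
    using that by (simp add: qf_eval_def scalar_prod_def)
  have "v = 0\<^sub>v 1" if v: "v \<in> carrier_vec 1" "\<And>w. w \<in> carrier_vec 1 \<Longrightarrow> qf_polar (1\<^sub>m 1) v w = 0" for v :: "'a vec"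
  proof -
    have "2 * v $ 0 = 0"
      using v(2)[of "vec 1 (\<lambda>_. 1)"] v(1) by (simp add: qf_polar_def scalar_prod_def)
    then show ?thesis using v(1) two_neq_zero[OF assms] by (intro eq_vecI) auto
  qed
  then have "qf_nonsingular (1\<^sub>m 1 :: 'a mat)" unfolding qf_nonsingular_def by simp
  moreover have "1 \<in> qf_values (1\<^sub>m 1 :: 'a mat)"
    unfolding qf_values_def by (rule image_eqI[of _ _ "vec 1 (\<lambda>_. 1)"]) (simp_all add: eval[simplified])
  moreover have "c \<cdot>\<^sub>q abs_qform (1\<^sub>m 1) = abs_qform (1\<^sub>m 1 :: 'a mat)"
    if "c \<in> qf_values (1\<^sub>m 1)" "c \<noteq> 0" for c
  proof -
    obtain v :: "'a vec" where "v \<in> carrier_vec 1" "c = qf_eval (1\<^sub>m 1) v"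
      using \<open>c \<in> qf_values (1\<^sub>m 1)\<close> unfolding qf_values_def by auto
    then show ?thesis using eval \<open>c \<noteq> 0\<close> by (auto intro: qscale_square)
  qed
  ultimately show ?thesis
    unfolding round_form_def by (simp only: nonsingular.abs_eq[OF one_mat_self] qvals.abs_eq[OF one_mat_self]) blast
qed

lemma binary_carrier: "qf_binary \<alpha> \<in> carrier_mat 2 2"
  unfolding qf_binary_def by (auto simp: mat_of_rows_list_def)

text \<open>
  The form \<open>[1, \<alpha>]\<close> is the norm form of the quadratic algebra generated by \<open>\<theta>\<close> with
  \<open>\<theta>\<^sup>2 = \<theta> - \<alpha>\<close>. Multiplication by an element \<open>x + y \<theta>\<close> of norm \<open>c\<close> multiplies norms by \<open>c\<close>; its
  matrix is \<open>P\<close>, with determinant \<open>c\<close>. Characteristic 2 makes the polar form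
  \<open>u\<^sub>0 v\<^sub>1 + u\<^sub>1 v\<^sub>0\<close>, which is nondegenerate.
\<close>

lemma round_binary:
  fixes \<alpha> :: "'a::field"
  assumes "CHAR('a) = 2"
  shows "round_form (abs_qform (qf_binary \<alpha>))"
proof -
  let ?A = "qf_binary \<alpha>"
  have self: "?A \<simeq>\<^sub>q ?A" by (rule qf_isometric_refl[OF binary_carrier])
  have two: "(2 :: 'a) = 0"
    using assms of_nat_CHAR[where 'a = 'a] by simp
  have form: "u \<bullet> (?A *\<^sub>v v) = u $ 0 * v $ 0 + u $ 0 * v $ 1 + \<alpha> * (u $ 1 * v $ 1)"
    if "u \<in> carrier_vec 2" "v \<in> carrier_vec 2" for u v
    using that unfolding qf_binary_def
    by (simp add: scalar_prod_def numeral_2_eq_2 mat_of_rows_list_def algebra_simps)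
  have eval: "qf_eval ?A v = v $ 0 * v $ 0 + v $ 0 * v $ 1 + \<alpha> * (v $ 1 * v $ 1)"
    if "v \<in> carrier_vec 2" for v using form[OF that that] unfolding qf_eval_def .
  have polar: "qf_polar ?A u v = u $ 0 * v $ 1 + u $ 1 * v $ 0"
    if "u \<in> carrier_vec 2" "v \<in> carrier_vec 2" for u v
  proof -
    have "qf_polar ?A u v = u $ 0 * v $ 1 + u $ 1 * v $ 0 + 2 * (u $ 0 * v $ 0 + \<alpha> * (u $ 1 * v $ 1))"
      unfolding qf_polar_def form[OF that] form[OF that(2,1)] by (simp add: algebra_simps)
    then show ?thesis unfolding two by simp
  qed
  have vec2_eqI: "u = v" if "u \<in> carrier_vec 2" "v \<in> carrier_vec 2" "u $ 0 = v $ 0" "u $ 1 = v $ 1" for u v :: "'a vec"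
    using that by (intro eq_vecI) (auto simp: numeral_2_eq_2 less_Suc_eq)
  have "v = 0\<^sub>v 2" if v: "v \<in> carrier_vec 2" "\<And>w. w \<in> carrier_vec 2 \<Longrightarrow> qf_polar ?A v w = 0" for v
    using v(2)[of "unit_vec 2 0"] v(2)[of "unit_vec 2 1"] v(1) by (intro vec2_eqI) (auto simp: polar)
  then have "qf_nonsingular ?A" using binary_carrier[of \<alpha>] unfolding qf_nonsingular_def by auto
  moreover have "1 \<in> qf_values ?A"
    using binary_carrier[of \<alpha>] unfolding qf_values_def
    by (intro image_eqI[of _ _ "unit_vec 2 0"]) (auto simp: eval)
  moreover have "c \<cdot>\<^sub>q abs_qform ?A = abs_qform ?A" if "c \<in> qf_values ?A" "c \<noteq> 0" for c
  proof -
    obtain u where u: "u \<in> carrier_vec 2" and c: "c = qf_eval ?A u"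
      using \<open>c \<in> qf_values ?A\<close> binary_carrier[of \<alpha>] unfolding qf_values_def by auto
    define x y where "x = u $ 0" and "y = u $ 1"
    have c: "c = x * x + x * y + \<alpha> * (y * y)" using c eval[OF u] unfolding x_def y_def by simp
    define P where "P = mat 2 2 (\<lambda>(i, j).
      if i = 0 then (if j = 0 then x else - (\<alpha> * y)) else (if j = 0 then y else x + y))"
    have P: "P \<in> carrier_mat 2 2" unfolding P_def by simp
    have P_index: "(P *\<^sub>v v) $ 0 = x * v $ 0 - \<alpha> * y * v $ 1" "(P *\<^sub>v v) $ 1 = y * v $ 0 + (x + y) * v $ 1"
      if "v \<in> carrier_vec 2" for v
      using that unfolding P_def by (simp_all add: scalar_prod_def numeral_2_eq_2)
    have "?A \<simeq>\<^sub>q c \<cdot>\<^sub>m ?A"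
    proof (rule qf_isometricI[OF binary_carrier _ P])
      show "c \<cdot>\<^sub>m ?A \<in> carrier_mat 2 2" using binary_carrier[of \<alpha>] by simp
      fix v :: "'a vec" assume v: "v \<in> carrier_vec 2"
      have Pv: "P *\<^sub>v v \<in> carrier_vec 2" using P v by simp
      show "v = 0\<^sub>v 2" if 0: "P *\<^sub>v v = 0\<^sub>v 2"
      proof -
        have 00: "x * v $ 0 - \<alpha> * y * v $ 1 = 0" "y * v $ 0 + (x + y) * v $ 1 = 0"
          using P_index[OF v] 0 by simp_all
        \<comment> \<open>Cramer's rule for the matrix \<open>P\<close>.\<close>
        have "c * v $ 0 = (x + y) * (x * v $ 0 - \<alpha> * y * v $ 1) + \<alpha> * y * (y * v $ 0 + (x + y) * v $ 1)"
          unfolding c by (simp add: algebra_simps)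
        moreover have "c * v $ 1 = x * (y * v $ 0 + (x + y) * v $ 1) - y * (x * v $ 0 - \<alpha> * y * v $ 1)"
          unfolding c by (simp add: algebra_simps)
        ultimately have "v $ 0 = 0" "v $ 1 = 0" unfolding 00 using \<open>c \<noteq> 0\<close> by simp_all
        then show ?thesis using v by (intro vec2_eqI) auto
      qed
      show "qf_eval ?A (P *\<^sub>v v) = qf_eval (c \<cdot>\<^sub>m ?A) v"
        unfolding eval[OF Pv] P_index[OF v] qf_eval_smult[OF binary_carrier v] eval[OF v] c
        by (simp add: algebra_simps)
    qed
    from isometricD(3)[OF this] show ?thesis unfolding abs_qform_smult[OF self] by (rule sym)
  qed
  ultimately show ?thesis
    unfolding round_form_def by (simp only: nonsingular.abs_eq[OF self] qvals.abs_eq[OF self]) blast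
qed

text \<open>
  By definition of \<^const>\<open>subseqs\<close>, the sublists of \<open>x # xs\<close> are those of \<open>xs\<close> with and without \<open>x\<close>. So
  the diagonal entries for \<open>x # xs\<close> are those for \<open>xs\<close> together with their multiples by \<open>-x\<close>.
\<close>

lemma abs_qf_pfister:
  "qf_pfister \<alpha>s \<simeq>\<^sub>q qf_pfister \<alpha>s"
  "abs_qform (qf_pfister \<alpha>s) = pfister \<alpha>s (abs_qform (1\<^sub>m 1 :: 'a::field mat))"
proof -
  define ds :: "'a list \<Rightarrow> 'a list" where "ds xs = map (\<lambda>s. (-1) ^ length s * prod_list s) (subseqs xs)" for xs
  have eq: "qf_pfister xs = ds xs \<otimes>\<^sub>q 1\<^sub>m 1" for xs
    unfolding qf_pfister_def ds_def Let_def mat_diag_tensor ..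
  show "qf_pfister \<alpha>s \<simeq>\<^sub>q qf_pfister \<alpha>s"
    unfolding eq by (rule abs_qform_tensor(1)[OF one_mat_self])
  have "tensor (ds xs) (abs_qform (1\<^sub>m 1)) = pfister xs (abs_qform (1\<^sub>m 1))" for xs
  proof (induction xs)
    case Nil
    then show ?case by (simp add: ds_def tensor_def)
  next
    case (Cons x xs)
    have "ds (x # xs) = map ((*) (- x)) (ds xs) @ ds xs"
      unfolding ds_def by (simp add: Let_def)
    then have "tensor (ds (x # xs)) q = (- x) \<cdot>\<^sub>q tensor (ds xs) q + tensor (ds xs) q" for q
      unfolding tensor_scale[symmetric] by (simp add: tensor_def o_def qscale_scale mult.commute)
    then show ?case using Cons by (simp add: add.commute)
  qed
  then show "abs_qform (qf_pfister \<alpha>s) = pfister \<alpha>s (abs_qform (1\<^sub>m 1 :: 'a mat))"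
    unfolding eq abs_qform_tensor(2)[OF one_mat_self] .
qed

text \<open>
  Slots preserve roundness by \<open>round_pfister\<close>; the bottom of the tower is \<open>round_unit\<close> or
  \<open>round_binary\<close>.
\<close>

lemma quadratic_pfister_round:
  assumes "quadratic_pfister n q"
  shows "q \<simeq>\<^sub>q q" "round_form (abs_qform q)" "qdim (abs_qform q) = 2 ^ n"
proof -
  have "q \<simeq>\<^sub>q q \<and> round_form (abs_qform q) \<and> qdim (abs_qform q) = 2 ^ n"
  proof (cases "CHAR('a) = 2")
    case True
    then obtain \<alpha>s \<alpha> where *: "length \<alpha>s = n - 1" "0 \<notin> set \<alpha>s" "q \<simeq>\<^sub>q bf_pfister \<alpha>s \<otimes>\<^sub>q qf_binary \<alpha>" "n \<ge> 1"
      using assms unfolding quadratic_pfister_def by auto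
    have self: "qf_binary \<alpha> \<simeq>\<^sub>q qf_binary \<alpha>" by (rule qf_isometric_refl[OF binary_carrier])
    have "abs_qform q = pfister \<alpha>s (abs_qform (qf_binary \<alpha>))"
      using isometricD(3)[OF *(3)] unfolding abs_qform_tensor(2)[OF self] tensor_pfister .
    moreover have "qdim (abs_qform (qf_binary \<alpha>)) = 2"
      using qdim.abs_eq[OF self] binary_carrier[of \<alpha>] by simp
    ultimately show ?thesis
      using * round_pfister[OF round_binary[OF True] *(2)] isometricD(1)[OF *(3)]
      by (auto simp: qdim_pfister power_Suc2[symmetric])
  next
    case False
    then obtain \<alpha>s where *: "length \<alpha>s = n" "0 \<notin> set \<alpha>s" "q \<simeq>\<^sub>q qf_pfister \<alpha>s"
      using assms unfolding quadratic_pfister_def by auto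
    have "abs_qform q = pfister \<alpha>s (abs_qform (1\<^sub>m 1))"
      using isometricD(3)[OF *(3)] unfolding abs_qf_pfister(2) .
    moreover have "qdim (abs_qform (1\<^sub>m 1 :: 'a mat)) = 1"
      using qdim.abs_eq[OF one_mat_self[of 1]] by simp
    ultimately show ?thesis
      using * round_pfister[OF round_unit[OF False] *(2)] isometricD(1)[OF *(3)] by (auto simp: qdim_pfister)
  qed
  then show "q \<simeq>\<^sub>q q" "round_form (abs_qform q)" "qdim (abs_qform q) = 2 ^ n" by auto
qed

lemma quadratic_pfister_multiple:
  assumes q: "quadratic_pfister n q" and as: "0 \<notin> set as"
    and p: "p \<simeq>\<^sub>q p" "abs_qform p = pfister as (abs_qform q)"
  shows "quadratic_pfister (length as + n) p"
proof (cases "CHAR('a) = 2")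
  case True
  then obtain \<alpha>s \<alpha> where *: "length \<alpha>s = n - 1" "0 \<notin> set \<alpha>s" "q \<simeq>\<^sub>q bf_pfister \<alpha>s \<otimes>\<^sub>q qf_binary \<alpha>" "n \<ge> 1"
    using q unfolding quadratic_pfister_def by auto
  have self: "qf_binary \<alpha> \<simeq>\<^sub>q qf_binary \<alpha>" by (rule qf_isometric_refl[OF binary_carrier])
  have "abs_qform q = pfister \<alpha>s (abs_qform (qf_binary \<alpha>))"
    using isometricD(3)[OF *(3)] unfolding abs_qform_tensor(2)[OF self] tensor_pfister .
  then have "abs_qform p = abs_qform (bf_pfister (as @ \<alpha>s) \<otimes>\<^sub>q qf_binary \<alpha>)"
    using p(2) by (simp add: abs_qform_tensor(2)[OF self] tensor_pfister pfister_append)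
  then have "p \<simeq>\<^sub>q bf_pfister (as @ \<alpha>s) \<otimes>\<^sub>q qf_binary \<alpha>"
    by (rule isometric_absI[OF p(1) abs_qform_tensor(1)[OF self]])
  then show ?thesis
    using * as True unfolding quadratic_pfister_def
    by (auto intro!: exI[of _ "as @ \<alpha>s"])
next
  case False
  then obtain \<alpha>s where *: "length \<alpha>s = n" "0 \<notin> set \<alpha>s" "q \<simeq>\<^sub>q qf_pfister \<alpha>s" "n \<ge> 1"
    using q unfolding quadratic_pfister_def by auto
  have "abs_qform q = pfister \<alpha>s (abs_qform (1\<^sub>m 1))"
    using isometricD(3)[OF *(3)] unfolding abs_qf_pfister(2) .
  then have "abs_qform p = abs_qform (qf_pfister (as @ \<alpha>s))"
    using p(2) by (simp add: abs_qf_pfister(2) pfister_append)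
  then have "p \<simeq>\<^sub>q qf_pfister (as @ \<alpha>s)"
    by (rule isometric_absI[OF p(1) abs_qf_pfister(1)])
  then show ?thesis
    using * as False unfolding quadratic_pfister_def
    by (auto intro!: exI[of _ "as @ \<alpha>s"])
qed

section \<open>The product map\<close>

lemma linked_product_isometric:
  assumes \<pi>: "quadratic_pfister k \<pi>" and \<mu>: "quadratic_pfister k \<mu>"
    and bp: "bilinear_pfister \<phi>\<^sub>1" "bilinear_pfister \<phi>\<^sub>2" "bilinear_pfister \<tau>\<^sub>1" "bilinear_pfister \<tau>\<^sub>2"
    and 1: "\<phi>\<^sub>1 \<otimes>\<^sub>q \<pi> \<simeq>\<^sub>q \<tau>\<^sub>1 \<otimes>\<^sub>q \<mu>" and 2: "\<phi>\<^sub>2 \<otimes>\<^sub>q \<pi> \<simeq>\<^sub>q \<tau>\<^sub>2 \<otimes>\<^sub>q \<mu>"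
  shows "(\<phi>\<^sub>1 \<otimes>\<^sub>b \<phi>\<^sub>2) \<otimes>\<^sub>q \<pi> \<simeq>\<^sub>q (\<tau>\<^sub>1 \<otimes>\<^sub>b \<tau>\<^sub>2) \<otimes>\<^sub>q \<mu>"
proof -
  note p = quadratic_pfister_round[OF \<pi>] and m = quadratic_pfister_round[OF \<mu>]
  obtain as where as: "0 \<notin> set as" "\<And>q. tensor \<phi>\<^sub>1 q = pfister as q" using bilinear_pfisterE[OF bp(1)] by blast
  obtain cs where cs: "0 \<notin> set cs" "\<And>q. tensor \<phi>\<^sub>2 q = pfister cs q" using bilinear_pfisterE[OF bp(2)] by blast
  obtain bs where bs: "0 \<notin> set bs" "\<And>q. tensor \<tau>\<^sub>1 q = pfister bs q" using bilinear_pfisterE[OF bp(3)] by blast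
  obtain ds where ds: "0 \<notin> set ds" "\<And>q. tensor \<tau>\<^sub>2 q = pfister ds q" using bilinear_pfisterE[OF bp(4)] by blast
  have eq1: "pfister as (abs_qform \<pi>) = pfister bs (abs_qform \<mu>)"
    using isometricD(3)[OF 1]
    unfolding abs_qform_tensor(2)[OF p(1)] abs_qform_tensor(2)[OF m(1)] as(2) bs(2) .
  have eq2: "pfister cs (abs_qform \<pi>) = pfister ds (abs_qform \<mu>)"
    using isometricD(3)[OF 2]
    unfolding abs_qform_tensor(2)[OF p(1)] abs_qform_tensor(2)[OF m(1)] cs(2) ds(2) .
  have "length as = length bs" "length cs = length ds"
    using arg_cong[OF eq1, of qdim] arg_cong[OF eq2, of qdim] unfolding qdim_pfister p(3) m(3) by simp_all
  then have "pfister as (pfister cs (abs_qform \<pi>)) = pfister bs (pfister ds (abs_qform \<mu>))"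
    using as(1) cs(1) bs(1) ds(1) eq1 eq2
    by (intro linked_pfister_product p(2) m(2)) (simp_all add: p(3) m(3))
  then have "abs_qform ((\<phi>\<^sub>1 \<otimes>\<^sub>b \<phi>\<^sub>2) \<otimes>\<^sub>q \<pi>) = abs_qform ((\<tau>\<^sub>1 \<otimes>\<^sub>b \<tau>\<^sub>2) \<otimes>\<^sub>q \<mu>)"
    by (simp add: abs_qform_tensor(2) p(1) m(1) tensor_bf_tensor as(2) bs(2) cs(2) ds(2))
  then show ?thesis
    by (rule isometric_absI[OF abs_qform_tensor(1)[OF p(1)] abs_qform_tensor(1)[OF m(1)]])
qed

lemma quadratic_pfister_product:
  assumes \<pi>: "quadratic_pfister k \<pi>" and bp: "bilinear_pfister \<phi>\<^sub>1" "bilinear_pfister \<phi>\<^sub>2"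
  shows "is_quadratic_pfister ((\<phi>\<^sub>1 \<otimes>\<^sub>b \<phi>\<^sub>2) \<otimes>\<^sub>q \<pi>)"
proof -
  note p = quadratic_pfister_round(1)[OF \<pi>]
  obtain as where as: "0 \<notin> set as" "\<And>q. tensor \<phi>\<^sub>1 q = pfister as q" using bilinear_pfisterE[OF bp(1)] by blast
  obtain cs where cs: "0 \<notin> set cs" "\<And>q. tensor \<phi>\<^sub>2 q = pfister cs q" using bilinear_pfisterE[OF bp(2)] by blast
  have "abs_qform ((\<phi>\<^sub>1 \<otimes>\<^sub>b \<phi>\<^sub>2) \<otimes>\<^sub>q \<pi>) = pfister (as @ cs) (abs_qform \<pi>)"
    unfolding abs_qform_tensor(2)[OF p] tensor_bf_tensor as(2) cs(2) pfister_append ..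
  then have "quadratic_pfister (length (as @ cs) + k) ((\<phi>\<^sub>1 \<otimes>\<^sub>b \<phi>\<^sub>2) \<otimes>\<^sub>q \<pi>)"
    using as cs by (intro quadratic_pfister_multiple[OF \<pi> _ abs_qform_tensor(1)[OF p]]) auto
  then show ?thesis unfolding is_quadratic_pfister_def by blast
qed

theorem theorem3p4:
  fixes k :: nat
  assumes "k \<ge> 1"
  shows "(\<exists>\<F> :: 'a::field mat set \<times> 'a mat set \<Rightarrow> 'a mat set.
            (\<forall>p \<in> PF2 k. \<F> p \<in> PF) \<and>
            (\<forall>\<psi>\<^sub>1 \<psi>\<^sub>2 \<pi> \<phi>\<^sub>1 \<phi>\<^sub>2.
               (qf_class \<psi>\<^sub>1, qf_class \<psi>\<^sub>2) \<in> PF2 k \<longrightarrow>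
               quadratic_pfister k \<pi> \<longrightarrow> bilinear_pfister \<phi>\<^sub>1 \<longrightarrow> bilinear_pfister \<phi>\<^sub>2 \<longrightarrow>
               \<psi>\<^sub>1 \<simeq>\<^sub>q \<phi>\<^sub>1 \<otimes>\<^sub>q \<pi> \<longrightarrow> \<psi>\<^sub>2 \<simeq>\<^sub>q \<phi>\<^sub>2 \<otimes>\<^sub>q \<pi> \<longrightarrow>
               \<F> (qf_class \<psi>\<^sub>1, qf_class \<psi>\<^sub>2) = qf_class ((\<phi>\<^sub>1 \<otimes>\<^sub>b \<phi>\<^sub>2) \<otimes>\<^sub>q \<pi>)))
       \<and> (\<forall>(\<psi>\<^sub>1 :: 'a mat) \<psi>\<^sub>2 \<pi> \<mu> \<phi>\<^sub>1 \<phi>\<^sub>2 \<tau>\<^sub>1 \<tau>\<^sub>2.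
            is_quadratic_pfister \<psi>\<^sub>1 \<longrightarrow> is_quadratic_pfister \<psi>\<^sub>2 \<longrightarrow>
            quadratic_pfister k \<pi> \<longrightarrow> quadratic_pfister k \<mu> \<longrightarrow>
            bilinear_pfister \<phi>\<^sub>1 \<longrightarrow> bilinear_pfister \<phi>\<^sub>2 \<longrightarrow>
            bilinear_pfister \<tau>\<^sub>1 \<longrightarrow> bilinear_pfister \<tau>\<^sub>2 \<longrightarrow>
            \<psi>\<^sub>1 \<simeq>\<^sub>q \<phi>\<^sub>1 \<otimes>\<^sub>q \<pi> \<longrightarrow> \<psi>\<^sub>1 \<simeq>\<^sub>q \<tau>\<^sub>1 \<otimes>\<^sub>q \<mu> \<longrightarrow>
            \<psi>\<^sub>2 \<simeq>\<^sub>q \<phi>\<^sub>2 \<otimes>\<^sub>q \<pi> \<longrightarrow> \<psi>\<^sub>2 \<simeq>\<^sub>q \<tau>\<^sub>2 \<otimes>\<^sub>q \<mu> \<longrightarrow>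
            (\<phi>\<^sub>1 \<otimes>\<^sub>b \<phi>\<^sub>2) \<otimes>\<^sub>q \<pi> \<simeq>\<^sub>q (\<tau>\<^sub>1 \<otimes>\<^sub>b \<tau>\<^sub>2) \<otimes>\<^sub>q \<mu>)"
proof -
  define factors :: "'a mat \<Rightarrow> 'a mat \<Rightarrow> 'a mat \<Rightarrow> 'a list \<Rightarrow> 'a list \<Rightarrow> bool" where
    "factors \<psi>\<^sub>1 \<psi>\<^sub>2 \<pi> \<phi>\<^sub>1 \<phi>\<^sub>2 \<longleftrightarrow> quadratic_pfister k \<pi> \<and> bilinear_pfister \<phi>\<^sub>1 \<and> bilinear_pfister \<phi>\<^sub>2 \<and>
       \<psi>\<^sub>1 \<simeq>\<^sub>q \<phi>\<^sub>1 \<otimes>\<^sub>q \<pi> \<and> \<psi>\<^sub>2 \<simeq>\<^sub>q \<phi>\<^sub>2 \<otimes>\<^sub>q \<pi>" for \<psi>\<^sub>1 \<psi>\<^sub>2 \<pi> \<phi>\<^sub>1 \<phi>\<^sub>2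
  have unique: "(\<phi>\<^sub>1 \<otimes>\<^sub>b \<phi>\<^sub>2) \<otimes>\<^sub>q \<pi> \<simeq>\<^sub>q (\<tau>\<^sub>1 \<otimes>\<^sub>b \<tau>\<^sub>2) \<otimes>\<^sub>q \<mu>"
    if "factors \<psi>\<^sub>1 \<psi>\<^sub>2 \<pi> \<phi>\<^sub>1 \<phi>\<^sub>2" "factors \<psi>\<^sub>1 \<psi>\<^sub>2 \<mu> \<tau>\<^sub>1 \<tau>\<^sub>2" for \<psi>\<^sub>1 \<psi>\<^sub>2 \<pi> \<mu> \<phi>\<^sub>1 \<phi>\<^sub>2 \<tau>\<^sub>1 \<tau>\<^sub>2
  proof -
    have "\<phi>\<^sub>1 \<otimes>\<^sub>q \<pi> \<simeq>\<^sub>q \<tau>\<^sub>1 \<otimes>\<^sub>q \<mu>" "\<phi>\<^sub>2 \<otimes>\<^sub>q \<pi> \<simeq>\<^sub>q \<tau>\<^sub>2 \<otimes>\<^sub>q \<mu>"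
      using that qf_isometric_trans[OF qf_isometric_sym] unfolding factors_def by blast+
    then show ?thesis
      using that unfolding factors_def by (intro linked_product_isometric[where k = k]) simp_all
  qed
  have class_eq: "qf_class A = qf_class B" if "A \<simeq>\<^sub>q B" for A B :: "'a mat"
    unfolding qf_class_def using that qf_isometric_sym qf_isometric_trans by blast
  have class_eqD: "A \<simeq>\<^sub>q B" if "qf_class A = qf_class B" "A \<simeq>\<^sub>q C" for A B C :: "'a mat"
  proof -
    have "A \<in> qf_class A" using isometricD(1)[OF that(2)] unfolding qf_class_def by simp
    then have "A \<in> qf_class B" unfolding that(1) .
    then have "B \<simeq>\<^sub>q A" unfolding qf_class_def by simp
    then show ?thesis by (rule qf_isometric_sym)
  qed
  define is_image :: "'a mat set \<times> 'a mat set \<Rightarrow> 'a mat set \<Rightarrow> bool" where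
    "is_image p X \<longleftrightarrow> (\<exists>\<psi>\<^sub>1 \<psi>\<^sub>2 \<pi> \<phi>\<^sub>1 \<phi>\<^sub>2. p = (qf_class \<psi>\<^sub>1, qf_class \<psi>\<^sub>2) \<and>
       factors \<psi>\<^sub>1 \<psi>\<^sub>2 \<pi> \<phi>\<^sub>1 \<phi>\<^sub>2 \<and> X = qf_class ((\<phi>\<^sub>1 \<otimes>\<^sub>b \<phi>\<^sub>2) \<otimes>\<^sub>q \<pi>))" for p X
  have is_image_unique: "X = Y" if "is_image p X" "is_image p Y" for p X Y
  proof -
    obtain \<psi>\<^sub>1 \<psi>\<^sub>2 \<pi> \<phi>\<^sub>1 \<phi>\<^sub>2 where X: "p = (qf_class \<psi>\<^sub>1, qf_class \<psi>\<^sub>2)" "factors \<psi>\<^sub>1 \<psi>\<^sub>2 \<pi> \<phi>\<^sub>1 \<phi>\<^sub>2"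
      "X = qf_class ((\<phi>\<^sub>1 \<otimes>\<^sub>b \<phi>\<^sub>2) \<otimes>\<^sub>q \<pi>)"
      using \<open>is_image p X\<close> unfolding is_image_def by blast
    obtain \<xi>\<^sub>1 \<xi>\<^sub>2 \<mu> \<tau>\<^sub>1 \<tau>\<^sub>2 where Y: "p = (qf_class \<xi>\<^sub>1, qf_class \<xi>\<^sub>2)" "factors \<xi>\<^sub>1 \<xi>\<^sub>2 \<mu> \<tau>\<^sub>1 \<tau>\<^sub>2"
      "Y = qf_class ((\<tau>\<^sub>1 \<otimes>\<^sub>b \<tau>\<^sub>2) \<otimes>\<^sub>q \<mu>)"
      using \<open>is_image p Y\<close> unfolding is_image_def by blast
    have "qf_class \<psi>\<^sub>1 = qf_class \<xi>\<^sub>1" "qf_class \<psi>\<^sub>2 = qf_class \<xi>\<^sub>2" using X(1) Y(1) by simp_all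
    then have "\<psi>\<^sub>1 \<simeq>\<^sub>q \<xi>\<^sub>1" "\<psi>\<^sub>2 \<simeq>\<^sub>q \<xi>\<^sub>2"
      using X(2) class_eqD unfolding factors_def by blast+
    then have "factors \<psi>\<^sub>1 \<psi>\<^sub>2 \<mu> \<tau>\<^sub>1 \<tau>\<^sub>2"
      using Y(2) qf_isometric_trans unfolding factors_def by blast
    then show ?thesis unfolding X(3) Y(3) by (intro class_eq unique[OF X(2)])
  qed
  \<comment> \<open>The value is unique where it exists, so any choice function will do.\<close>
  define \<F> where "\<F> p = (SOME X. is_image p X)" for p
  have \<F>: "\<F> p = X" if "is_image p X" for p X
    using someI[of "is_image p", OF that] is_image_unique[OF _ that] unfolding \<F>_def by blast
  have "\<F> p \<in> PF" if "p \<in> PF2 k" for p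
  proof -
    obtain \<psi>\<^sub>1 \<psi>\<^sub>2 \<pi> \<phi>\<^sub>1 \<phi>\<^sub>2 where "p = (qf_class \<psi>\<^sub>1, qf_class \<psi>\<^sub>2)" and fac: "factors \<psi>\<^sub>1 \<psi>\<^sub>2 \<pi> \<phi>\<^sub>1 \<phi>\<^sub>2"
      using \<open>p \<in> PF2 k\<close> unfolding PF2_def linked_def factors_def by blast
    then have "\<F> p = qf_class ((\<phi>\<^sub>1 \<otimes>\<^sub>b \<phi>\<^sub>2) \<otimes>\<^sub>q \<pi>)"
      by (intro \<F>) (unfold is_image_def, blast)
    moreover have "is_quadratic_pfister ((\<phi>\<^sub>1 \<otimes>\<^sub>b \<phi>\<^sub>2) \<otimes>\<^sub>q \<pi>)"
      using fac unfolding factors_def by (blast intro: quadratic_pfister_product)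
    ultimately show ?thesis unfolding PF_def by blast
  qed
  moreover have "\<F> (qf_class \<psi>\<^sub>1, qf_class \<psi>\<^sub>2) = qf_class ((\<phi>\<^sub>1 \<otimes>\<^sub>b \<phi>\<^sub>2) \<otimes>\<^sub>q \<pi>)"
    if "factors \<psi>\<^sub>1 \<psi>\<^sub>2 \<pi> \<phi>\<^sub>1 \<phi>\<^sub>2" for \<psi>\<^sub>1 \<psi>\<^sub>2 \<pi> \<phi>\<^sub>1 \<phi>\<^sub>2
    using that by (intro \<F>) (unfold is_image_def, blast)
  ultimately show ?thesis
    using unique unfolding factors_def by (intro conjI exI[of _ \<F>]) blast+
qed

end
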